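(* Let $2<p<\infty$ and let $w=(w_n)$ be a sequence of positive reals with $w_n\to0$ and $\sum_n w_n^{2p/(p-2)}=\infty$. Then the Rosenthal space $X_{p,w}$ is isomorphic to a $7.35\,(p/\log p)$-orthogonally complemented subspace of $L_p[0,1]$ (with $\log$ the natural logarithm).
   Context: For $2<p<\infty$ and a sequence $w=(w_n)$ of positive reals, $X_{p,w}$ is the space of real sequences $(x_n)$ with $(x_n)\in\ell_p$ and $(x_nw_n)\in\ell_2$, with norm $\|(x_n)\|=\max\{\|(x_n)\|_{\ell_p},\|(x_nw_n)\|_{\ell_2}\}$. For a probability space $(\Omega,\mathcal A,\mu)$ and $C>0$, an orthogonal projection $P$ on $L_2(\Omega)$ is $p$-$C$-bounded if $\|Pf\|_p\le C\|f\|_p$ for all $f\in L_2\cap L_p$; a subspace $X\subseteq L_p(\Omega)$ is $C$-orthogonally complemented if it is the $\|\cdot\|_p$-closure of $P(L_2\cap L_p)$ for some $p$-$C$-bounded orthogonal projection $P$. *)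

theory Defs
  imports "HOL-Analysis.Analysis"
begin

abbreviation U :: "real measure" where "U \<equiv> lebesgue_on {0..1}"

text \<open>Membership in L_q[0,1] (functions, with a.e. identification handled explicitly).\<close>
definition memLq :: "real \<Rightarrow> (real \<Rightarrow> real) \<Rightarrow> bool" where
  "memLq q f \<longleftrightarrow> f \<in> borel_measurable U \<and> integrable U (\<lambda>t. \<bar>f t\<bar> powr q)"

definition normLq :: "real \<Rightarrow> (real \<Rightarrow> real) \<Rightarrow> real" where
  "normLq q f = (integral\<^sup>L U (\<lambda>t. \<bar>f t\<bar> powr q)) powr (1 / q)"

definition ae_eq :: "(real \<Rightarrow> real) \<Rightarrow> (real \<Rightarrow> real) \<Rightarrow> bool" where
  "ae_eq f g \<longleftrightarrow> (AE t in U. f t = g t)"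

definition orth_proj_L2 :: "((real \<Rightarrow> real) \<Rightarrow> (real \<Rightarrow> real)) \<Rightarrow> bool" where
  "orth_proj_L2 P \<longleftrightarrow>
     (\<forall>f. memLq 2 f \<longrightarrow> memLq 2 (P f)) \<and>
     (\<forall>f g. memLq 2 f \<longrightarrow> memLq 2 g \<longrightarrow> ae_eq f g \<longrightarrow> ae_eq (P f) (P g)) \<and>
     (\<forall>f g a b. memLq 2 f \<longrightarrow> memLq 2 g \<longrightarrow>
        ae_eq (P (\<lambda>t. a * f t + b * g t)) (\<lambda>t. a * P f t + b * P g t)) \<and>
     (\<forall>f. memLq 2 f \<longrightarrow> ae_eq (P (P f)) (P f)) \<and>
     (\<forall>f g. memLq 2 f \<longrightarrow> memLq 2 g \<longrightarrow>
        integral\<^sup>L U (\<lambda>t. P f t * g t) = integral\<^sup>L U (\<lambda>t. f t * P g t))"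

definition p_C_bounded :: "real \<Rightarrow> real \<Rightarrow> ((real \<Rightarrow> real) \<Rightarrow> (real \<Rightarrow> real)) \<Rightarrow> bool" where
  "p_C_bounded p C P \<longleftrightarrow>
     (\<forall>f. memLq 2 f \<and> memLq p f \<longrightarrow> memLq p (P f) \<and> normLq p (P f) \<le> C * normLq p f)"

definition Lp_closure_range :: "real \<Rightarrow> ((real \<Rightarrow> real) \<Rightarrow> (real \<Rightarrow> real)) \<Rightarrow> (real \<Rightarrow> real) set" where
  "Lp_closure_range p P = {g. memLq p g \<and>
     (\<forall>e>0. \<exists>f. memLq 2 f \<and> memLq p f \<and> normLq p (\<lambda>t. g t - P f t) < e)}"

definition C_orth_complemented :: "real \<Rightarrow> real \<Rightarrow> (real \<Rightarrow> real) set \<Rightarrow> bool" where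
  "C_orth_complemented p C X \<longleftrightarrow>
     (\<exists>P. orth_proj_L2 P \<and> p_C_bounded p C P \<and> X = Lp_closure_range p P)"

definition in_Xpw :: "real \<Rightarrow> (nat \<Rightarrow> real) \<Rightarrow> (nat \<Rightarrow> real) \<Rightarrow> bool" where
  "in_Xpw p w x \<longleftrightarrow> summable (\<lambda>n. \<bar>x n\<bar> powr p) \<and> summable (\<lambda>n. (x n * w n)\<^sup>2)"

definition norm_Xpw :: "real \<Rightarrow> (nat \<Rightarrow> real) \<Rightarrow> (nat \<Rightarrow> real) \<Rightarrow> real" where
  "norm_Xpw p w x = max ((\<Sum>n. \<bar>x n\<bar> powr p) powr (1 / p)) (sqrt (\<Sum>n. (x n * w n)\<^sup>2))"

definition Xpw_isomorphic_to :: "real \<Rightarrow> (nat \<Rightarrow> real) \<Rightarrow> (real \<Rightarrow> real) set \<Rightarrow> bool" where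
  "Xpw_isomorphic_to p w X \<longleftrightarrow>
     (\<exists>T :: (nat \<Rightarrow> real) \<Rightarrow> (real \<Rightarrow> real). \<exists>a b. 0 < a \<and> 0 < b \<and>
        (\<forall>x. in_Xpw p w x \<longrightarrow> T x \<in> X) \<and>
        (\<forall>x y c d. in_Xpw p w x \<longrightarrow> in_Xpw p w y \<longrightarrow>
            ae_eq (T (\<lambda>n. c * x n + d * y n)) (\<lambda>t. c * T x t + d * T y t)) \<and>
        (\<forall>x. in_Xpw p w x \<longrightarrow>
            a * norm_Xpw p w x \<le> normLq p (T x) \<and> normLq p (T x) \<le> b * norm_Xpw p w x) \<and>
        (\<forall>g\<in>X. \<exists>x. in_Xpw p w x \<and> ae_eq (T x) g))"

end

theory Submission
  imports Defs "HOL-Probability.Probability"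
begin

text \<open>
  Let \<open>f\<^sub>n\<close> be independent symmetric functions on \<open>[0,1]\<close> with values in \<open>{-1, 0, 1}\<close> and \<open>f\<^sub>n \<noteq> 0\<close> on a
  set of measure \<open>m\<^sub>n\<close>, where \<open>m\<^sub>n\<close> is comparable to \<open>w\<^sub>n\<^bsup>2p/(p-2)\<^esup>\<close>, and let \<open>P\<close> be the orthogonal
  projection onto their closed span, with coefficients \<open>b\<^sub>n = \<langle>g, f\<^sub>n\<rangle> / m\<^sub>n\<close>. Two estimates control \<open>P\<close> on
  \<open>L\<^sub>p\<close>. First, \<open>\<Sum> \<bar>b\<^sub>n\<bar>\<^sup>p m\<^sub>n \<le> \<integral> \<bar>g\<bar>\<^sup>p\<close>, which is dual to the type \<open>q\<close> inequality
  \<open>E \<bar>\<Sum> X\<^sub>n\<bar>\<^sup>q \<le> \<Sum> E \<bar>X\<^sub>n\<bar>\<^sup>q\<close> of independent symmetric variables for the conjugate exponent \<open>q \<le> 2\<close>;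
  together with Bessel's inequality it also gives the lower estimate of the isomorphism. Second,
  Rosenthal's inequality
  \<open>\<parallel>\<Sum> X\<^sub>n\<parallel>\<^sub>p \<le> 6.8 (p / ln p) max {(\<Sum> E \<bar>X\<^sub>n\<bar>\<^sup>p)\<^bsup>1/p\<^esup>, (\<Sum> E X\<^sub>n\<^sup>2)\<^bsup>1/2\<^esup>}\<close>. With the maximum normalised
  to 1, the parts of the \<open>X\<^sub>n\<close> bounded by 2 have exponential moments
  \<open>E exp (\<plusminus> l \<Sum> X\<^sub>n) \<le> exp ((cosh (2 l) - 1) / 4) \<le> exp (p / 8)\<close> at \<open>l = (ln p) / 2\<close>, and the
  remaining parts are nonzero with total probability at most \<open>2\<^bsup>-p\<^esup>\<close>, so that even
  \<open>\<bar>x + y\<bar>\<^sup>p \<le> 2\<^bsup>p-1\<^esup> (\<bar>x\<bar>\<^sup>p + \<bar>y\<bar>\<^sup>p)\<close>, applied once per summand, loses only a bounded factor.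
\<close>

subsection \<open>Elementary inequalities\<close>

lemma power2_eq_abs_powr: "x\<^sup>2 = \<bar>x\<bar> powr 2" for x :: real
  by (cases "x = 0") (simp_all add: powr_numeral)

lemma convex_on_abs_powr:
  assumes "1 \<le> r"
  shows "convex_on UNIV (\<lambda>x::real. \<bar>x\<bar> powr r)"
proof (rule convex_onI)
  have scaled: "(t * u) powr r \<le> t * u powr r" if "0 < t" "t < 1" "0 \<le> u" for t u :: real
  proof -
    have "t powr r \<le> t powr 1"
      using that assms by (intro powr_mono') auto
    then show ?thesis
      using that by (simp add: powr_mult mult_right_mono)
  qed
  fix t x y :: real
  assume t: "0 < t" "t < 1"
  have "\<bar>(1 - t) * x + t * y\<bar> \<le> (1 - t) * \<bar>x\<bar> + t * \<bar>y\<bar>"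
    using t abs_triangle_ineq[of "(1 - t) * x" "t * y"] by (simp add: abs_mult)
  then have "\<bar>(1 - t) * x + t * y\<bar> powr r \<le> ((1 - t) * \<bar>x\<bar> + t * \<bar>y\<bar>) powr r"
    using assms by (intro powr_mono2) auto
  also have "\<dots> \<le> (1 - t) * \<bar>x\<bar> powr r + t * \<bar>y\<bar> powr r"
  proof (cases "x = 0 \<or> y = 0")
    case True
    then show ?thesis
      using t scaled[of t "\<bar>y\<bar>"] scaled[of "1 - t" "\<bar>x\<bar>"] by auto
  next
    case False
    then show ?thesis
      using t convex_onD[OF powr_convex[OF assms], of t "\<bar>x\<bar>" "\<bar>y\<bar>"] by simp
  qed
  finally show "\<bar>(1 - t) *\<^sub>R x + t *\<^sub>R y\<bar> powr r \<le> (1 - t) * \<bar>x\<bar> powr r + t * \<bar>y\<bar> powr r"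
    by simp
qed simp

lemma abs_midpoint_powr_le:
  fixes x y :: real
  assumes "1 \<le> r"
  shows "\<bar>(x + y) / 2\<bar> powr r \<le> (\<bar>x\<bar> powr r + \<bar>y\<bar> powr r) / 2"
  using convex_onD[OF convex_on_abs_powr[OF assms], of "1 / 2" x y]
  by (simp add: add_divide_distrib)

lemma abs_add_powr_le:
  fixes x y :: real
  assumes "1 \<le> r"
  shows "\<bar>x + y\<bar> powr r \<le> 2 powr (r - 1) * (\<bar>x\<bar> powr r + \<bar>y\<bar> powr r)"
  using abs_midpoint_powr_le[OF assms, of x y] by (simp add: powr_diff powr_divide field_simps)

lemma abs_sgn_mult_abs_powr: "\<bar>sgn x * \<bar>x\<bar> powr r\<bar> = \<bar>x\<bar> powr r" for x :: real
  by (cases "x = 0") (simp_all add: abs_mult)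

lemma sgn_mult_abs_powr_mult: "sgn x * \<bar>x\<bar> powr (p - 1) * x = \<bar>x\<bar> powr p" for x :: real
proof -
  have "sgn x * \<bar>x\<bar> powr (p - 1) * x = \<bar>x\<bar> * \<bar>x\<bar> powr (p - 1)"
    by (simp add: abs_sgn mult_ac)
  then show ?thesis
    by (simp add: powr_mult_base)
qed

lemma powr_add_le:
  fixes x y :: real
  assumes "0 \<le> x" "0 \<le> y" "0 < r" "r \<le> 1"
  shows "(x + y) powr r \<le> x powr r + y powr r"
proof (cases "x + y = 0")
  case False
  then have pos: "0 < x + y"
    using assms by linarith
  have ratio_le: "z / (x + y) \<le> (z / (x + y)) powr r" if "0 \<le> z" "z \<le> x + y" for z
  proof (cases "z = 0")
    case False
    then show ?thesis
      using that pos assms powr_mono'[of r 1 "z / (x + y)"] by simp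
  qed simp
  have "1 = x / (x + y) + y / (x + y)"
    using pos by (simp add: add_divide_distrib[symmetric])
  also have "\<dots> \<le> (x / (x + y)) powr r + (y / (x + y)) powr r"
    using assms by (intro add_mono ratio_le) auto
  also have "\<dots> = (x powr r + y powr r) / (x + y) powr r"
    by (simp add: powr_divide add_divide_distrib)
  finally show ?thesis
    using pos by (simp add: field_simps)
qed (use assms in auto)

text \<open>For \<open>q = 2\<close> this is the parallelogram law, from which the general case follows by concavity of
  \<open>x \<mapsto> x powr (q / 2)\<close>.\<close>

lemma abs_add_abs_diff_powr_le:
  fixes x y :: real
  assumes "1 \<le> q" "q \<le> 2"
  shows "(\<bar>x + y\<bar> powr q + \<bar>x - y\<bar> powr q) / 2 \<le> \<bar>x\<bar> powr q + \<bar>y\<bar> powr q"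
proof -
  define mean where "mean = (\<bar>x + y\<bar> powr q + \<bar>x - y\<bar> powr q) / 2"
  have "0 \<le> mean"
    by (simp add: mean_def)
  have "mean powr (2 / q) \<le> ((x + y)\<^sup>2 + (x - y)\<^sup>2) / 2"
    using abs_midpoint_powr_le[of "2 / q" "\<bar>x + y\<bar> powr q" "\<bar>x - y\<bar> powr q"] assms
    by (simp add: mean_def powr_powr power2_eq_abs_powr[symmetric] del: powr_numeral)
  also have "\<dots> = x\<^sup>2 + y\<^sup>2"
    by (simp add: power2_eq_square algebra_simps)
  finally have "(mean powr (2 / q)) powr (q / 2) \<le> (x\<^sup>2 + y\<^sup>2) powr (q / 2)"
    using assms by (intro powr_mono2) auto
  also have "\<dots> \<le> (x\<^sup>2) powr (q / 2) + (y\<^sup>2) powr (q / 2)"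
    using assms by (intro powr_add_le) auto
  also have "\<dots> = \<bar>x\<bar> powr q + \<bar>y\<bar> powr q"
    by (simp only: power2_eq_abs_powr powr_powr) simp
  finally show ?thesis
    using assms \<open>0 \<le> mean\<close> by (simp add: powr_powr mean_def)
qed

lemma cosh_mult_minus_one_le:
  fixes \<theta> y :: real
  assumes "\<bar>\<theta>\<bar> \<le> 1"
  shows "cosh (\<theta> * y) - 1 \<le> \<theta>\<^sup>2 * (cosh y - 1)"
proof -
  let ?cosh_term = "\<lambda>y n. if even n then y ^ n /\<^sub>R fact n else (0::real)"
  let ?bound = "\<lambda>n. (if n = 0 then 1 - \<theta>\<^sup>2 else 0) + \<theta>\<^sup>2 * ?cosh_term y n"
  have bound_sums: "?bound sums ((1 - \<theta>\<^sup>2) + \<theta>\<^sup>2 * cosh y)"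
    by (intro sums_add sums_mult cosh_converges sums_If_finite_set[of "{0}" "\<lambda>_. 1 - \<theta>\<^sup>2", simplified])
  have "?cosh_term (\<theta> * y) n \<le> ?bound n" for n
  proof (cases "even n \<and> n \<noteq> 0")
    case True
    then have "2 \<le> n" by (auto elim: evenE)
    have "\<theta> ^ n = \<bar>\<theta>\<bar> ^ n"
      using True by (simp add: power_even_abs)
    also have "\<dots> \<le> \<bar>\<theta>\<bar> ^ 2"
      using assms \<open>2 \<le> n\<close> by (intro power_decreasing) auto
    finally have "\<theta> ^ n * (y ^ n / fact n) \<le> \<theta>\<^sup>2 * (y ^ n / fact n)"
      using True by (intro mult_right_mono) (auto intro!: divide_nonneg_pos zero_le_even_power)
    then show ?thesis
      using True by (simp add: power_mult_distrib field_simps)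
  qed auto
  then show ?thesis
    using sums_le[OF _ cosh_converges bound_sums] by (simp add: algebra_simps)
qed

lemma abs_powr_le_exp:
  fixes x :: real
  assumes "0 < l" "0 < p"
  shows "\<bar>x\<bar> powr p \<le> (p / l) powr p * (exp (l * x) + exp (- l * x))"
proof -
  have "l * \<bar>x\<bar> / p \<le> exp (l * \<bar>x\<bar> / p)"
    using exp_ge_add_one_self[of "l * \<bar>x\<bar> / p"] by linarith
  then have "(l * \<bar>x\<bar> / p) powr p \<le> exp (l * \<bar>x\<bar> / p) powr p"
    using assms by (intro powr_mono2) auto
  also have "\<dots> = exp (l * \<bar>x\<bar>)"
    using assms by (simp add: powr_def)
  also have "\<dots> \<le> exp (l * x) + exp (- l * x)"
    by (simp add: abs_if)
  finally have "(p / l) powr p * (l * \<bar>x\<bar> / p) powr p \<le> (p / l) powr p * (exp (l * x) + exp (- l * x))"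
    by (intro mult_left_mono) auto
  then show ?thesis
    using assms by (simp flip: powr_mult)
qed

subsection \<open>Absolute moments\<close>

lemma integrable_abs_powr_add:
  fixes f g :: "'a \<Rightarrow> real"
  assumes "1 \<le> p"
    and [measurable]: "f \<in> borel_measurable M" "g \<in> borel_measurable M"
    and "integrable M (\<lambda>x. \<bar>f x\<bar> powr p)" "integrable M (\<lambda>x. \<bar>g x\<bar> powr p)"
  shows "integrable M (\<lambda>x. \<bar>f x + g x\<bar> powr p)"
proof (rule Bochner_Integration.integrable_bound)
  show "integrable M (\<lambda>x. 2 powr (p - 1) * (\<bar>f x\<bar> powr p + \<bar>g x\<bar> powr p))"
    using assms by simp
  show "AE x in M. norm (\<bar>f x + g x\<bar> powr p) \<le> norm (2 powr (p - 1) * (\<bar>f x\<bar> powr p + \<bar>g x\<bar> powr p))"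
    using abs_add_powr_le[OF \<open>1 \<le> p\<close>] by simp
qed measurable

lemma integrable_abs_powr_sum:
  fixes f :: "'i \<Rightarrow> 'a \<Rightarrow> real"
  assumes "1 \<le> p"
    and "\<And>i. i \<in> I \<Longrightarrow> f i \<in> borel_measurable M"
    and "\<And>i. i \<in> I \<Longrightarrow> integrable M (\<lambda>x. \<bar>f i x\<bar> powr p)"
  shows "integrable M (\<lambda>x. \<bar>\<Sum>i\<in>I. f i x\<bar> powr p)"
  using assms(2,3)
proof (induction I rule: infinite_finite_induct)
  case (insert i I)
  then show ?case
    by (simp add: integrable_abs_powr_add[OF \<open>1 \<le> p\<close>])
qed auto

lemma integrable_abs_powr_sum_comp:
  fixes X :: "'i \<Rightarrow> 'a \<Rightarrow> real" and g :: "real \<Rightarrow> real"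
  assumes [measurable]: "g \<in> borel_measurable borel" and g_le: "\<And>x. \<bar>g x\<bar> \<le> \<bar>x\<bar>"
    and "1 \<le> p" and rv: "\<And>i. i \<in> I \<Longrightarrow> X i \<in> borel_measurable M"
    and int: "\<And>i. i \<in> I \<Longrightarrow> integrable M (\<lambda>\<omega>. \<bar>X i \<omega>\<bar> powr p)"
  shows "integrable M (\<lambda>\<omega>. \<bar>\<Sum>i\<in>I. g (X i \<omega>)\<bar> powr p)"
proof (rule integrable_abs_powr_sum[OF \<open>1 \<le> p\<close>])
  show "integrable M (\<lambda>\<omega>. \<bar>g (X i \<omega>)\<bar> powr p)" if "i \<in> I" for i
    using rv[OF that] \<open>1 \<le> p\<close> g_le
    by (intro Bochner_Integration.integrable_bound[OF int[OF that]]) (auto intro!: powr_mono2)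
qed (use rv in auto)

context prob_space
begin

lemma integrable_abs_powr_mono:
  fixes f :: "'a \<Rightarrow> real" and p q :: real
  assumes [measurable]: "f \<in> borel_measurable M"
    and "0 < q" "q \<le> p" "integrable M (\<lambda>x. \<bar>f x\<bar> powr p)"
  shows "integrable M (\<lambda>x. \<bar>f x\<bar> powr q)"
proof (rule Bochner_Integration.integrable_bound)
  show "integrable M (\<lambda>x. 1 + \<bar>f x\<bar> powr p)"
    using assms by simp
  have "y powr q \<le> 1 + y powr p" if "0 \<le> y" for y :: real
  proof (cases "y \<le> 1")
    case True
    then have "y powr q \<le> 1"
      using that assms by (intro powr_le1) auto
    then show ?thesis
      by (simp add: add_increasing2)
  next
    case False
    then show ?thesis
      using assms by (simp add: add_increasing powr_mono)
  qed
  then show "AE x in M. norm (\<bar>f x\<bar> powr q) \<le> norm (1 + \<bar>f x\<bar> powr p)"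
    by simp
qed measurable

lemma expectation_abs_powr_mono:
  fixes f :: "'a \<Rightarrow> real"
  assumes "f \<in> borel_measurable M" "0 < q" "q \<le> p" "integrable M (\<lambda>x. \<bar>f x\<bar> powr p)"
  shows "expectation (\<lambda>x. \<bar>f x\<bar> powr q) powr (1 / q) \<le> expectation (\<lambda>x. \<bar>f x\<bar> powr p) powr (1 / p)"
proof -
  let ?moment = "\<lambda>r. expectation (\<lambda>x. \<bar>f x\<bar> powr r)"
  have "\<bar>?moment q\<bar> powr (p / q) \<le> expectation (\<lambda>x. \<bar>\<bar>f x\<bar> powr q\<bar> powr (p / q))"
    using assms
    by (intro jensens_inequality[where q = "\<lambda>x::real. \<bar>x\<bar> powr (p / q)" and I = UNIV] convex_on_abs_powr)
      (auto intro: integrable_abs_powr_mono simp: powr_powr)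
  then have "(?moment q powr (p / q)) powr (1 / p) \<le> ?moment p powr (1 / p)"
    using assms by (intro powr_mono2) (auto simp: powr_powr)
  then show ?thesis
    using assms by (simp add: powr_powr)
qed

end

subsection \<open>Sums of independent symmetric random variables\<close>

definition (in prob_space) symmetric_var :: "('a \<Rightarrow> real) \<Rightarrow> bool" where
  "symmetric_var X \<longleftrightarrow> random_variable borel X \<and> distr M borel (\<lambda>\<omega>. - X \<omega>) = distr M borel X"

context prob_space
begin

lemma symmetric_var_measurable: "symmetric_var X \<Longrightarrow> X \<in> borel_measurable M"
  by (simp add: symmetric_var_def)

lemma symmetric_var_odd_comp:
  assumes X: "symmetric_var X" and g [measurable]: "g \<in> borel_measurable borel"
    and odd: "\<And>x. g (- x) = - g x"
  shows "symmetric_var (\<lambda>\<omega>. g (X \<omega>))"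
proof -
  have [measurable]: "X \<in> borel_measurable M"
    by (rule symmetric_var_measurable[OF X])
  have "distr M borel (\<lambda>\<omega>. - g (X \<omega>)) = distr (distr M borel (\<lambda>\<omega>. - X \<omega>)) borel g"
    by (simp add: distr_distr comp_def odd)
  also have "\<dots> = distr M borel (\<lambda>\<omega>. g (X \<omega>))"
    using X by (simp add: symmetric_var_def distr_distr comp_def)
  finally show ?thesis
    by (simp add: symmetric_var_def)
qed

lemma expectation_uminus_symmetric_var:
  fixes \<phi> :: "real \<Rightarrow> real"
  assumes X: "symmetric_var X" and [measurable]: "\<phi> \<in> borel_measurable borel"
  shows "expectation (\<lambda>\<omega>. \<phi> (- X \<omega>)) = expectation (\<lambda>\<omega>. \<phi> (X \<omega>))"
proof -
  have [measurable]: "X \<in> borel_measurable M"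
    by (rule symmetric_var_measurable[OF X])
  have "expectation (\<lambda>\<omega>. \<phi> (- X \<omega>)) = (\<integral>x. \<phi> x \<partial>distr M borel (\<lambda>\<omega>. - X \<omega>))"
    by (simp add: integral_distr)
  also have "\<dots> = (\<integral>x. \<phi> x \<partial>distr M borel X)"
    using X by (simp add: symmetric_var_def)
  finally show ?thesis
    by (simp add: integral_distr)
qed

lemma expectation_symmetric_var: "symmetric_var X \<Longrightarrow> expectation X = 0"
  using expectation_uminus_symmetric_var[of X "\<lambda>x. x"] by simp

lemma expectation_uminus_symmetric_indep_var:
  fixes \<phi> :: "real \<times> real \<Rightarrow> real"
  assumes X: "symmetric_var X" and indep: "indep_var borel X borel Y"
    and [measurable]: "\<phi> \<in> borel_measurable (borel \<Otimes>\<^sub>M borel)"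
  shows "expectation (\<lambda>\<omega>. \<phi> (- X \<omega>, Y \<omega>)) = expectation (\<lambda>\<omega>. \<phi> (X \<omega>, Y \<omega>))"
proof -
  have [measurable]: "X \<in> borel_measurable M" "Y \<in> borel_measurable M"
    using indep_var_rv1[OF indep] indep_var_rv2[OF indep] by simp_all
  have "indep_var borel (\<lambda>\<omega>. - X \<omega>) borel Y"
    using indep_var_compose[OF indep, of uminus borel id borel] by (simp add: comp_def)
  then have joint_law: "distr M (borel \<Otimes>\<^sub>M borel) (\<lambda>\<omega>. (- X \<omega>, Y \<omega>))
      = distr M (borel \<Otimes>\<^sub>M borel) (\<lambda>\<omega>. (X \<omega>, Y \<omega>))"
    using indep X by (simp add: indep_var_distribution_eq symmetric_var_def)
  have "expectation (\<lambda>\<omega>. \<phi> (- X \<omega>, Y \<omega>))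
      = (\<integral>z. \<phi> z \<partial>distr M (borel \<Otimes>\<^sub>M borel) (\<lambda>\<omega>. (- X \<omega>, Y \<omega>)))"
    by (simp add: integral_distr)
  also have "\<dots> = expectation (\<lambda>\<omega>. \<phi> (X \<omega>, Y \<omega>))"
    by (simp add: joint_law integral_distr)
  finally show ?thesis .
qed

lemma expectation_abs_add_powr_le:
  assumes "1 \<le> q" "q \<le> 2"
    and X: "symmetric_var X" and indep: "indep_var borel X borel Y"
    and int_X: "integrable M (\<lambda>\<omega>. \<bar>X \<omega>\<bar> powr q)" and int_Y: "integrable M (\<lambda>\<omega>. \<bar>Y \<omega>\<bar> powr q)"
  shows "expectation (\<lambda>\<omega>. \<bar>X \<omega> + Y \<omega>\<bar> powr q)
    \<le> expectation (\<lambda>\<omega>. \<bar>X \<omega>\<bar> powr q) + expectation (\<lambda>\<omega>. \<bar>Y \<omega>\<bar> powr q)"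
proof -
  have meas: "X \<in> borel_measurable M" "Y \<in> borel_measurable M"
    using indep_var_rv1[OF indep] indep_var_rv2[OF indep] by simp_all
  have int_add: "integrable M (\<lambda>\<omega>. \<bar>X \<omega> + Y \<omega>\<bar> powr q)"
    using assms(1) meas int_X int_Y by (rule integrable_abs_powr_add)
  have int_diff: "integrable M (\<lambda>\<omega>. \<bar>X \<omega> - Y \<omega>\<bar> powr q)"
    using integrable_abs_powr_add[of q X M "\<lambda>\<omega>. - Y \<omega>"] assms(1) meas int_X int_Y by simp
  have "expectation (\<lambda>\<omega>. \<bar>X \<omega> - Y \<omega>\<bar> powr q) = expectation (\<lambda>\<omega>. \<bar>- X \<omega> + Y \<omega>\<bar> powr q)"
    by (simp add: abs_minus_commute)
  also have "\<dots> = expectation (\<lambda>\<omega>. \<bar>X \<omega> + Y \<omega>\<bar> powr q)"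
    using expectation_uminus_symmetric_indep_var[OF X indep, of "\<lambda>(x, y). \<bar>x + y\<bar> powr q"] by simp
  finally have "expectation (\<lambda>\<omega>. \<bar>X \<omega> + Y \<omega>\<bar> powr q)
      = expectation (\<lambda>\<omega>. (\<bar>X \<omega> + Y \<omega>\<bar> powr q + \<bar>X \<omega> - Y \<omega>\<bar> powr q) / 2)"
    using int_add int_diff by simp
  also have "\<dots> \<le> expectation (\<lambda>\<omega>. \<bar>X \<omega>\<bar> powr q + \<bar>Y \<omega>\<bar> powr q)"
    using assms(1,2) int_add int_diff int_X int_Y
    by (intro integral_mono abs_add_abs_diff_powr_le) auto
  finally show ?thesis
    using int_X int_Y by simp
qed

lemma expectation_abs_sum_powr_le:
  assumes "finite I" "indep_vars (\<lambda>_. borel) X I"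
    and "1 \<le> q" "q \<le> 2"
    and "\<And>i. i \<in> I \<Longrightarrow> symmetric_var (X i)"
    and "\<And>i. i \<in> I \<Longrightarrow> integrable M (\<lambda>\<omega>. \<bar>X i \<omega>\<bar> powr q)"
  shows "expectation (\<lambda>\<omega>. \<bar>\<Sum>i\<in>I. X i \<omega>\<bar> powr q) \<le> (\<Sum>i\<in>I. expectation (\<lambda>\<omega>. \<bar>X i \<omega>\<bar> powr q))"
  using assms(1,2,5,6)
proof (induction I rule: finite_induct)
  case (insert i I)
  have "expectation (\<lambda>\<omega>. \<bar>X i \<omega> + (\<Sum>j\<in>I. X j \<omega>)\<bar> powr q)
      \<le> expectation (\<lambda>\<omega>. \<bar>X i \<omega>\<bar> powr q) + expectation (\<lambda>\<omega>. \<bar>\<Sum>j\<in>I. X j \<omega>\<bar> powr q)"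
    using insert assms(3,4)
    by (intro expectation_abs_add_powr_le indep_vars_sum integrable_abs_powr_sum)
      (auto intro: symmetric_var_measurable)
  also have "expectation (\<lambda>\<omega>. \<bar>\<Sum>j\<in>I. X j \<omega>\<bar> powr q) \<le> (\<Sum>j\<in>I. expectation (\<lambda>\<omega>. \<bar>X j \<omega>\<bar> powr q))"
    using insert by (intro insert.IH) (auto intro: indep_vars_subset)
  finally show ?case
    using insert.hyps by simp
qed simp

lemma integrable_exp_bounded:
  fixes X :: "'a \<Rightarrow> real"
  assumes "X \<in> borel_measurable M" and "\<And>\<omega>. \<omega> \<in> space M \<Longrightarrow> \<bar>X \<omega>\<bar> \<le> b"
  shows "integrable M (\<lambda>\<omega>. exp (l * X \<omega>))"
proof (rule integrable_const_bound)
  show "AE \<omega> in M. norm (exp (l * X \<omega>)) \<le> exp (\<bar>l\<bar> * b)"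
  proof (rule AE_I2)
    fix \<omega> assume "\<omega> \<in> space M"
    then have "\<bar>l\<bar> * \<bar>X \<omega>\<bar> \<le> \<bar>l\<bar> * b"
      by (intro mult_left_mono assms) auto
    then show "norm (exp (l * X \<omega>)) \<le> exp (\<bar>l\<bar> * b)"
      using abs_ge_self[of "l * X \<omega>"] by (simp add: abs_mult)
  qed
qed (use assms in measurable)

lemma expectation_exp_symmetric_var_le:
  assumes X: "symmetric_var X" and bounded: "\<And>\<omega>. \<omega> \<in> space M \<Longrightarrow> \<bar>X \<omega>\<bar> \<le> b" and "0 < b"
  shows "expectation (\<lambda>\<omega>. exp (l * X \<omega>)) \<le> exp ((cosh (l * b) - 1) / b\<^sup>2 * expectation (\<lambda>\<omega>. (X \<omega>)\<^sup>2))"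
proof -
  let ?k = "(cosh (l * b) - 1) / b\<^sup>2"
  have [measurable]: "X \<in> borel_measurable M"
    by (rule symmetric_var_measurable[OF X])
  have int_exp: "integrable M (\<lambda>\<omega>. exp (l * X \<omega>))" for l
    using bounded by (intro integrable_exp_bounded) auto
  have int_square: "integrable M (\<lambda>\<omega>. (X \<omega>)\<^sup>2)"
  proof (rule integrable_const_bound)
    show "AE \<omega> in M. norm ((X \<omega>)\<^sup>2) \<le> b\<^sup>2"
      using power_mono[OF bounded, of _ 2] by (intro AE_I2) auto
  qed measurable
  have cosh_le: "cosh (l * X \<omega>) \<le> 1 + ?k * (X \<omega>)\<^sup>2" if "\<omega> \<in> space M" for \<omega>
    using cosh_mult_minus_one_le[of "X \<omega> / b" "l * b"] bounded[OF that] \<open>0 < b\<close>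
    by (simp add: power_divide mult.commute)
  have "expectation (\<lambda>\<omega>. exp (l * X \<omega>)) = expectation (\<lambda>\<omega>. cosh (l * X \<omega>))"
    using expectation_uminus_symmetric_var[OF X, of "\<lambda>x. exp (l * x)"] int_exp[of l] int_exp[of "- l"]
    by (simp add: cosh_field_def)
  also have "\<dots> \<le> expectation (\<lambda>\<omega>. 1 + ?k * (X \<omega>)\<^sup>2)"
    using int_exp[of l] int_exp[of "- l"] int_square
    by (intro integral_mono cosh_le) (auto simp: cosh_field_def)
  also have "\<dots> = 1 + ?k * expectation (\<lambda>\<omega>. (X \<omega>)\<^sup>2)"
    using int_square prob_space by simp
  also have "\<dots> \<le> exp (?k * expectation (\<lambda>\<omega>. (X \<omega>)\<^sup>2))"
    by (rule exp_ge_add_one_self)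
  finally show ?thesis .
qed

lemma expectation_exp_sum_symmetric_var_le:
  assumes "finite I" and indep: "indep_vars (\<lambda>_. borel) X I"
    and sym: "\<And>i. i \<in> I \<Longrightarrow> symmetric_var (X i)"
    and bounded: "\<And>i \<omega>. i \<in> I \<Longrightarrow> \<omega> \<in> space M \<Longrightarrow> \<bar>X i \<omega>\<bar> \<le> b" and "0 < b"
  shows "expectation (\<lambda>\<omega>. exp (l * (\<Sum>i\<in>I. X i \<omega>)))
    \<le> exp ((cosh (l * b) - 1) / b\<^sup>2 * (\<Sum>i\<in>I. expectation (\<lambda>\<omega>. (X i \<omega>)\<^sup>2)))"
proof -
  have "expectation (\<lambda>\<omega>. exp (l * (\<Sum>i\<in>I. X i \<omega>))) = expectation (\<lambda>\<omega>. \<Prod>i\<in>I. exp (l * X i \<omega>))"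
    using \<open>finite I\<close> by (simp add: exp_sum sum_distrib_left)
  also have "\<dots> = (\<Prod>i\<in>I. expectation (\<lambda>\<omega>. exp (l * X i \<omega>)))"
  proof (rule indep_vars_lebesgue_integral[OF \<open>finite I\<close>])
    show "indep_vars (\<lambda>_. borel) (\<lambda>i \<omega>. exp (l * X i \<omega>)) I"
      using indep_vars_compose2[OF indep, of "\<lambda>_ x. exp (l * x)" "\<lambda>_. borel"] by simp
  qed (use sym bounded in \<open>auto intro: integrable_exp_bounded symmetric_var_measurable\<close>)
  also have "\<dots> \<le> (\<Prod>i\<in>I. exp ((cosh (l * b) - 1) / b\<^sup>2 * expectation (\<lambda>\<omega>. (X i \<omega>)\<^sup>2)))"
    by (intro prod_mono conjI expectation_exp_symmetric_var_le sym bounded \<open>0 < b\<close>) auto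
  also have "\<dots> = exp ((cosh (l * b) - 1) / b\<^sup>2 * (\<Sum>i\<in>I. expectation (\<lambda>\<omega>. (X i \<omega>)\<^sup>2)))"
    using \<open>finite I\<close> by (simp only: exp_sum sum_distrib_left)
  finally show ?thesis .
qed

lemma expectation_abs_sum_powr_le_bounded:
  assumes "finite I" and "indep_vars (\<lambda>_. borel) X I"
    and sym: "\<And>i. i \<in> I \<Longrightarrow> symmetric_var (X i)"
    and bounded: "\<And>i \<omega>. i \<in> I \<Longrightarrow> \<omega> \<in> space M \<Longrightarrow> \<bar>X i \<omega>\<bar> \<le> b" and "0 < b"
    and "0 < l" "0 < p"
  shows "expectation (\<lambda>\<omega>. \<bar>\<Sum>i\<in>I. X i \<omega>\<bar> powr p)
    \<le> (p / l) powr p * (2 * exp ((cosh (l * b) - 1) / b\<^sup>2 * (\<Sum>i\<in>I. expectation (\<lambda>\<omega>. (X i \<omega>)\<^sup>2))))"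
    (is "_ \<le> _ * (2 * ?bound)")
proof -
  define sum_X where "sum_X \<omega> = (\<Sum>i\<in>I. X i \<omega>)" for \<omega>
  have [measurable]: "sum_X \<in> borel_measurable M"
    unfolding sum_X_def using sym by (intro borel_measurable_sum) (rule symmetric_var_measurable)
  have int_exp: "integrable M (\<lambda>\<omega>. exp (s * sum_X \<omega>))" for s
  proof (rule integrable_exp_bounded)
    show "\<bar>sum_X \<omega>\<bar> \<le> (\<Sum>i\<in>I. b)" if "\<omega> \<in> space M" for \<omega>
      unfolding sum_X_def using bounded that by (intro order_trans[OF sum_abs] sum_mono) auto
  qed measurable
  have exp_le: "expectation (\<lambda>\<omega>. exp (s * sum_X \<omega>)) \<le> ?bound" if "s \<in> {l, - l}" for s
    using expectation_exp_sum_symmetric_var_le[OF assms(1-5), of s] that by (auto simp: sum_X_def)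
  have "expectation (\<lambda>\<omega>. \<bar>sum_X \<omega>\<bar> powr p)
      \<le> expectation (\<lambda>\<omega>. (p / l) powr p * (exp (l * sum_X \<omega>) + exp (- l * sum_X \<omega>)))"
  proof (rule integral_mono')
    show "integrable M (\<lambda>\<omega>. (p / l) powr p * (exp (l * sum_X \<omega>) + exp (- l * sum_X \<omega>)))"
      using int_exp[of l] int_exp[of "- l"] by simp
  qed (use \<open>0 < l\<close> \<open>0 < p\<close> in \<open>auto intro: abs_powr_le_exp[simplified]\<close>)
  also have "\<dots> = (p / l) powr p * (expectation (\<lambda>\<omega>. exp (l * sum_X \<omega>))
      + expectation (\<lambda>\<omega>. exp (- l * sum_X \<omega>)))"
    using int_exp[of l] int_exp[of "- l"] by simp
  also have "\<dots> \<le> (p / l) powr p * (2 * ?bound)"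
    using exp_le[of l] exp_le[of "- l"] by (intro mult_left_mono) auto
  finally show ?thesis
    by (simp only: sum_X_def)
qed

lemma expectation_abs_add_powr_le_prob_nonzero:
  assumes "1 \<le> p" and indep: "indep_var borel X borel Y"
    and int_X: "integrable M (\<lambda>\<omega>. \<bar>X \<omega>\<bar> powr p)" and int_Y: "integrable M (\<lambda>\<omega>. \<bar>Y \<omega>\<bar> powr p)"
  shows "expectation (\<lambda>\<omega>. \<bar>X \<omega> + Y \<omega>\<bar> powr p)
    \<le> (1 + 2 powr (p - 1) * \<P>(\<omega> in M. X \<omega> \<noteq> 0)) * expectation (\<lambda>\<omega>. \<bar>Y \<omega>\<bar> powr p)
      + 2 powr (p - 1) * expectation (\<lambda>\<omega>. \<bar>X \<omega>\<bar> powr p)"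
proof -
  define k :: real where "k = 2 powr (p - 1)"
  have [measurable]: "X \<in> borel_measurable M" "Y \<in> borel_measurable M"
    using indep_var_rv1[OF indep] indep_var_rv2[OF indep] by simp_all
  define active where "active \<omega> = (indicator (- {0}) (X \<omega>) :: real)" for \<omega>
  have "indep_var borel active borel (\<lambda>\<omega>. \<bar>Y \<omega>\<bar> powr p)"
    using indep_var_compose[OF indep, of "indicator (- {0})" borel "\<lambda>y. \<bar>y\<bar> powr p" borel]
    by (simp add: comp_def active_def[abs_def])
  moreover have "integrable M active"
    unfolding active_def by (rule integrable_const_bound[of _ 1]) auto
  ultimately have int_product: "integrable M (\<lambda>\<omega>. active \<omega> * \<bar>Y \<omega>\<bar> powr p)"
    and product: "expectation (\<lambda>\<omega>. active \<omega> * \<bar>Y \<omega>\<bar> powr p)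
      = expectation active * expectation (\<lambda>\<omega>. \<bar>Y \<omega>\<bar> powr p)"
    using int_Y by (simp_all add: indep_var_integrable indep_var_lebesgue_integral)
  have "expectation active = expectation (indicator {\<omega> \<in> space M. X \<omega> \<noteq> 0})"
    by (intro Bochner_Integration.integral_cong) (auto simp: active_def indicator_def)
  then have expectation_active: "expectation active = \<P>(\<omega> in M. X \<omega> \<noteq> 0)"
    by simp
  have "\<bar>X \<omega> + Y \<omega>\<bar> powr p \<le> \<bar>Y \<omega>\<bar> powr p + k * (active \<omega> * \<bar>Y \<omega>\<bar> powr p + \<bar>X \<omega>\<bar> powr p)" for \<omega>
  proof (cases "X \<omega> = 0")
    case False
    then show ?thesis
      by (intro order_trans[OF abs_add_powr_le[OF \<open>1 \<le> p\<close>]]) (simp add: active_def k_def algebra_simps)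
  qed (simp add: active_def)
  then have "expectation (\<lambda>\<omega>. \<bar>X \<omega> + Y \<omega>\<bar> powr p)
      \<le> expectation (\<lambda>\<omega>. \<bar>Y \<omega>\<bar> powr p + k * (active \<omega> * \<bar>Y \<omega>\<bar> powr p + \<bar>X \<omega>\<bar> powr p))"
    using \<open>1 \<le> p\<close> int_X int_Y int_product by (intro integral_mono integrable_abs_powr_add) auto
  also have "\<dots> = (1 + k * \<P>(\<omega> in M. X \<omega> \<noteq> 0)) * expectation (\<lambda>\<omega>. \<bar>Y \<omega>\<bar> powr p)
      + k * expectation (\<lambda>\<omega>. \<bar>X \<omega>\<bar> powr p)"
    using int_X int_Y int_product by (simp add: product expectation_active algebra_simps)
  finally show ?thesis
    by (simp only: k_def)
qed

lemma expectation_abs_sum_powr_le_prob_nonzero: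
  assumes "finite I" "indep_vars (\<lambda>_. borel) X I" and "1 \<le> p"
    and "\<And>i. i \<in> I \<Longrightarrow> integrable M (\<lambda>\<omega>. \<bar>X i \<omega>\<bar> powr p)"
  shows "expectation (\<lambda>\<omega>. \<bar>\<Sum>i\<in>I. X i \<omega>\<bar> powr p)
    \<le> 2 powr (p - 1) * exp (2 powr (p - 1) * (\<Sum>i\<in>I. \<P>(\<omega> in M. X i \<omega> \<noteq> 0)))
      * (\<Sum>i\<in>I. expectation (\<lambda>\<omega>. \<bar>X i \<omega>\<bar> powr p))"
  using assms(1,2,4)
proof (induction I rule: finite_induct)
  case (insert i I)
  define k :: real where "k = 2 powr (p - 1)"
  define pr where "pr = \<P>(\<omega> in M. X i \<omega> \<noteq> 0)"
  define pr_sum where "pr_sum = (\<Sum>j\<in>I. \<P>(\<omega> in M. X j \<omega> \<noteq> 0))"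
  define mom where "mom = expectation (\<lambda>\<omega>. \<bar>X i \<omega>\<bar> powr p)"
  define mom_sum where "mom_sum = (\<Sum>j\<in>I. expectation (\<lambda>\<omega>. \<bar>X j \<omega>\<bar> powr p))"
  have nonneg: "0 \<le> k" "0 \<le> pr" "0 \<le> pr_sum" "0 \<le> mom"
    by (auto simp: k_def pr_def pr_sum_def mom_def intro!: sum_nonneg)
  have IH: "expectation (\<lambda>\<omega>. \<bar>\<Sum>j\<in>I. X j \<omega>\<bar> powr p) \<le> k * exp (k * pr_sum) * mom_sum"
    unfolding k_def pr_sum_def mom_sum_def
    using insert by (intro insert.IH) (auto intro: indep_vars_subset)
  have rv: "X j \<in> borel_measurable M" if "j \<in> insert i I" for j
    using insert.prems(1) that by (auto simp: indep_vars_def)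
  have "expectation (\<lambda>\<omega>. \<bar>X i \<omega> + (\<Sum>j\<in>I. X j \<omega>)\<bar> powr p)
      \<le> (1 + k * pr) * expectation (\<lambda>\<omega>. \<bar>\<Sum>j\<in>I. X j \<omega>\<bar> powr p) + k * mom"
    unfolding k_def pr_def mom_def using insert rv \<open>1 \<le> p\<close>
    by (intro expectation_abs_add_powr_le_prob_nonzero indep_vars_sum integrable_abs_powr_sum) auto
  also have "\<dots> \<le> exp (k * pr) * (k * exp (k * pr_sum) * mom_sum) + k * mom * exp (k * (pr_sum + pr))"
  proof (rule add_mono)
    show "(1 + k * pr) * expectation (\<lambda>\<omega>. \<bar>\<Sum>j\<in>I. X j \<omega>\<bar> powr p)
        \<le> exp (k * pr) * (k * exp (k * pr_sum) * mom_sum)"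
      using IH by (intro mult_mono exp_ge_add_one_self) auto
    show "k * mom \<le> k * mom * exp (k * (pr_sum + pr))"
      using nonneg mult_left_mono[of 1 "exp (k * (pr_sum + pr))" "k * mom"] by simp
  qed
  also have "\<dots> = k * exp (k * (pr + pr_sum)) * (mom + mom_sum)"
    by (simp add: exp_add algebra_simps)
  finally show ?case
    using insert.hyps by (simp add: k_def pr_def pr_sum_def mom_def mom_sum_def)
qed simp

end

subsection \<open>Rosenthal's inequality\<close>

definition truncate_abs :: "real \<Rightarrow> real \<Rightarrow> real" where
  "truncate_abs b x = (if \<bar>x\<bar> \<le> b then x else 0)"

lemma truncate_abs_measurable [measurable]: "truncate_abs b \<in> borel_measurable borel"
  unfolding truncate_abs_def by measurable

lemma ln_le_half: "ln p \<le> p / 2" if "0 < p" for p :: real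
proof -
  have "ln p = ln (p / 2) + ln 2"
    using that by (simp add: ln_div)
  then show ?thesis
    using ln_le_minus_one[of "p / 2"] that ln_2_less_1 by linarith
qed

lemma two_exp_le_powr: "2 * exp (p / 8) \<le> (17 / 10) powr p" if "2 \<le> p" for p :: real
proof -
  have "(2::real) powr 1 \<le> 2 powr (p / 2)"
    using that by (intro powr_mono) auto
  then have two_le: "2 \<le> (2 powr 4) powr (p / 8 :: real)"
    by (simp only: powr_powr) simp
  have "exp (p / 8) = exp 1 powr (p / 8)"
    by (simp add: powr_def)
  also have "\<dots> \<le> 3 powr (p / 8)"
    using that exp_le by (intro powr_mono2) auto
  finally have "2 * exp (p / 8) \<le> (2 powr 4) powr (p / 8) * 3 powr (p / 8)"
    using two_le by (intro mult_mono) auto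
  also have "\<dots> = 48 powr (p / 8)"
    by (simp flip: powr_mult)
  also have "\<dots> \<le> ((17 / 10) powr 8) powr (p / 8)"
    using that by (intro powr_mono2) (auto simp: power_divide)
  also have "\<dots> = (17 / 10) powr p"
    by (simp only: powr_powr) simp
  finally show ?thesis .
qed

context prob_space
begin

lemma expectation_sum_truncated_powr_le:
  assumes "finite I" and indep: "indep_vars (\<lambda>_. borel) X I"
    and sym: "\<And>i. i \<in> I \<Longrightarrow> symmetric_var (X i)"
    and int: "\<And>i. i \<in> I \<Longrightarrow> integrable M (\<lambda>\<omega>. (X i \<omega>)\<^sup>2)"
    and variance_le: "(\<Sum>i\<in>I. expectation (\<lambda>\<omega>. (X i \<omega>)\<^sup>2)) \<le> 1"
    and "2 \<le> p"
  shows "expectation (\<lambda>\<omega>. \<bar>\<Sum>i\<in>I. truncate_abs 2 (X i \<omega>)\<bar> powr p) \<le> (3.4 * (p / ln p)) powr p"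
proof -
  define l where "l = ln p / 2"
  have "0 < l"
    using \<open>2 \<le> p\<close> by (simp add: l_def)
  let ?var = "\<Sum>i\<in>I. expectation (\<lambda>\<omega>. (truncate_abs 2 (X i \<omega>))\<^sup>2)"
  have "?var \<le> (\<Sum>i\<in>I. expectation (\<lambda>\<omega>. (X i \<omega>)\<^sup>2))"
    using int by (intro sum_mono integral_mono') (auto simp: truncate_abs_def)
  then have "?var \<le> 1"
    using variance_le by simp
  have "cosh (l * 2) - 1 \<le> p / 2"
    using \<open>2 \<le> p\<close> by (simp add: l_def cosh_ln_real field_simps)
  then have "(cosh (l * 2) - 1) / 2\<^sup>2 * ?var \<le> p / 8 * 1"
    using \<open>?var \<le> 1\<close> \<open>2 \<le> p\<close> by (intro mult_mono) (auto intro: sum_nonneg)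
  then have "2 * exp ((cosh (l * 2) - 1) / 2\<^sup>2 * ?var) \<le> (17 / 10) powr p"
    by (intro order_trans[OF _ two_exp_le_powr[OF \<open>2 \<le> p\<close>]]) simp
  moreover have "expectation (\<lambda>\<omega>. \<bar>\<Sum>i\<in>I. truncate_abs 2 (X i \<omega>)\<bar> powr p)
      \<le> (p / l) powr p * (2 * exp ((cosh (l * 2) - 1) / 2\<^sup>2 * ?var))"
  proof (rule expectation_abs_sum_powr_le_bounded[OF \<open>finite I\<close>])
    show "indep_vars (\<lambda>_. borel) (\<lambda>i \<omega>. truncate_abs 2 (X i \<omega>)) I"
      by (rule indep_vars_compose2[OF indep]) measurable
    show "symmetric_var (\<lambda>\<omega>. truncate_abs 2 (X i \<omega>))" if "i \<in> I" for i
      by (rule symmetric_var_odd_comp[OF sym[OF that]]) (auto simp: truncate_abs_def)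
    show "\<bar>truncate_abs 2 (X i \<omega>)\<bar> \<le> 2" for i \<omega>
      by (simp add: truncate_abs_def)
  qed (use \<open>0 < l\<close> \<open>2 \<le> p\<close> in auto)
  ultimately have "expectation (\<lambda>\<omega>. \<bar>\<Sum>i\<in>I. truncate_abs 2 (X i \<omega>)\<bar> powr p)
      \<le> (p / l) powr p * (17 / 10) powr p"
    by (meson mult_left_mono order_trans powr_ge_zero)
  also have "\<dots> = (3.4 * (p / ln p)) powr p"
    by (simp add: l_def flip: powr_mult)
  finally show ?thesis .
qed

lemma prob_neq_truncate_abs_le:
  assumes [measurable]: "X \<in> borel_measurable M" and "integrable M (\<lambda>\<omega>. \<bar>X \<omega>\<bar> powr p)"
    and "0 < b" "0 \<le> p"
  shows "\<P>(\<omega> in M. X \<omega> - truncate_abs b (X \<omega>) \<noteq> 0) \<le> expectation (\<lambda>\<omega>. \<bar>X \<omega>\<bar> powr p) / b powr p"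
proof -
  have "\<P>(\<omega> in M. X \<omega> - truncate_abs b (X \<omega>) \<noteq> 0) \<le> \<P>(\<omega> in M. b powr p \<le> \<bar>X \<omega>\<bar> powr p)"
    using \<open>0 < b\<close> \<open>0 \<le> p\<close>
    by (intro finite_measure_mono) (auto simp: truncate_abs_def intro: powr_mono2 split: if_splits)
  also have "\<dots> \<le> expectation (\<lambda>\<omega>. \<bar>X \<omega>\<bar> powr p) / b powr p"
    using assms by (intro integral_Markov_inequality_measure[where A = "space M"]) auto
  finally show ?thesis .
qed

lemma expectation_sum_tail_powr_le:
  assumes "finite I" and indep: "indep_vars (\<lambda>_. borel) X I"
    and int: "\<And>i. i \<in> I \<Longrightarrow> integrable M (\<lambda>\<omega>. \<bar>X i \<omega>\<bar> powr p)"
    and moment_le: "(\<Sum>i\<in>I. expectation (\<lambda>\<omega>. \<bar>X i \<omega>\<bar> powr p)) \<le> 1"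
    and "1 \<le> p"
  shows "expectation (\<lambda>\<omega>. \<bar>\<Sum>i\<in>I. X i \<omega> - truncate_abs 2 (X i \<omega>)\<bar> powr p) \<le> 2 powr p"
proof -
  define tail where "tail i \<omega> = X i \<omega> - truncate_abs 2 (X i \<omega>)" for i \<omega>
  let ?pr = "\<Sum>i\<in>I. \<P>(\<omega> in M. tail i \<omega> \<noteq> 0)" and ?mom = "\<Sum>i\<in>I. expectation (\<lambda>\<omega>. \<bar>tail i \<omega>\<bar> powr p)"
  have rv [measurable]: "X i \<in> borel_measurable M" if "i \<in> I" for i
    using indep that by (auto simp: indep_vars_def)
  have rv_tail [measurable]: "tail i \<in> borel_measurable M" if "i \<in> I" for i
    unfolding tail_def using rv[OF that] by measurable
  have tail_le: "\<bar>tail i \<omega>\<bar> powr p \<le> \<bar>X i \<omega>\<bar> powr p" for i \<omega>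
    by (simp add: tail_def truncate_abs_def)
  have int_tail: "integrable M (\<lambda>\<omega>. \<bar>tail i \<omega>\<bar> powr p)" if "i \<in> I" for i
    using tail_le that rv_tail[OF that]
    by (intro Bochner_Integration.integrable_bound[OF int[OF that]]) auto
  have "?mom \<le> (\<Sum>i\<in>I. expectation (\<lambda>\<omega>. \<bar>X i \<omega>\<bar> powr p))"
    using int int_tail tail_le by (intro sum_mono integral_mono) auto
  then have "?mom \<le> 1"
    using moment_le by simp
  have "?pr \<le> (\<Sum>i\<in>I. expectation (\<lambda>\<omega>. \<bar>X i \<omega>\<bar> powr p) / 2 powr p)"
    unfolding tail_def using rv int \<open>1 \<le> p\<close> by (intro sum_mono prob_neq_truncate_abs_le) auto
  also have "\<dots> \<le> 1 / 2 powr p"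
    using moment_le by (simp add: divide_right_mono flip: sum_divide_distrib)
  finally have "2 powr (p - 1) * ?pr \<le> 2 powr (p - 1) * (1 / 2 powr p)"
    by (intro mult_left_mono) auto
  also have "\<dots> = 1 / 2"
    by (simp add: powr_diff)
  also have "\<dots> \<le> ln 2"
    using ln2_ge_two_thirds by simp
  finally have "exp (2 powr (p - 1) * ?pr) \<le> exp (ln 2)"
    by (simp only: exp_le_cancel_iff)
  then have "2 powr (p - 1) * exp (2 powr (p - 1) * ?pr) * ?mom \<le> 2 powr (p - 1) * 2 * 1"
    using \<open>?mom \<le> 1\<close> by (intro mult_mono) (auto intro: sum_nonneg)
  moreover have "expectation (\<lambda>\<omega>. \<bar>\<Sum>i\<in>I. tail i \<omega>\<bar> powr p)
      \<le> 2 powr (p - 1) * exp (2 powr (p - 1) * ?pr) * ?mom"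
  proof (rule expectation_abs_sum_powr_le_prob_nonzero[OF \<open>finite I\<close> _ \<open>1 \<le> p\<close> int_tail])
    show "indep_vars (\<lambda>_. borel) tail I"
      unfolding tail_def by (rule indep_vars_compose2[OF indep]) measurable
  qed
  ultimately have "expectation (\<lambda>\<omega>. \<bar>\<Sum>i\<in>I. tail i \<omega>\<bar> powr p) \<le> 2 powr (p - 1) * 2 * 1"
    by linarith
  then show ?thesis
    by (simp add: tail_def powr_diff)
qed

lemma rosenthal_normalized:
  assumes "finite I" and "indep_vars (\<lambda>_. borel) X I"
    and sym: "\<And>i. i \<in> I \<Longrightarrow> symmetric_var (X i)"
    and "2 < p" and int: "\<And>i. i \<in> I \<Longrightarrow> integrable M (\<lambda>\<omega>. \<bar>X i \<omega>\<bar> powr p)"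
    and "(\<Sum>i\<in>I. expectation (\<lambda>\<omega>. \<bar>X i \<omega>\<bar> powr p)) \<le> 1"
    and "(\<Sum>i\<in>I. expectation (\<lambda>\<omega>. (X i \<omega>)\<^sup>2)) \<le> 1"
  shows "expectation (\<lambda>\<omega>. \<bar>\<Sum>i\<in>I. X i \<omega>\<bar> powr p) \<le> (6.8 * (p / ln p)) powr p"
proof -
  define r where "r = p / ln p"
  have "2 \<le> r"
    using ln_le_half[of p] \<open>2 < p\<close> by (simp add: r_def field_simps)
  define small where "small \<omega> = (\<Sum>i\<in>I. truncate_abs 2 (X i \<omega>))" for \<omega>
  define large where "large \<omega> = (\<Sum>i\<in>I. X i \<omega> - truncate_abs 2 (X i \<omega>))" for \<omega>
  have sum_split: "(\<Sum>i\<in>I. X i \<omega>) = small \<omega> + large \<omega>" for \<omega>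
    by (simp add: small_def large_def sum_subtractf)
  have rv: "X i \<in> borel_measurable M" if "i \<in> I" for i
    using symmetric_var_measurable[OF sym[OF that]] .
  have int_small: "integrable M (\<lambda>\<omega>. \<bar>small \<omega>\<bar> powr p)"
    unfolding small_def using \<open>2 < p\<close> rv int
    by (intro integrable_abs_powr_sum_comp[of "truncate_abs 2"]) (auto simp: truncate_abs_def)
  have int_large: "integrable M (\<lambda>\<omega>. \<bar>large \<omega>\<bar> powr p)"
    unfolding large_def using \<open>2 < p\<close> rv int
    by (intro integrable_abs_powr_sum_comp[of "\<lambda>x. x - truncate_abs 2 x"]) (auto simp: truncate_abs_def)
  have "integrable M (\<lambda>\<omega>. (X i \<omega>)\<^sup>2)" if "i \<in> I" for i
    using integrable_abs_powr_mono[OF rv[OF that] _ _ int[OF that], of 2] \<open>2 < p\<close>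
    by (simp add: power2_eq_abs_powr del: powr_numeral)
  then have small_le: "expectation (\<lambda>\<omega>. \<bar>small \<omega>\<bar> powr p) \<le> (3.4 * r) powr p"
    unfolding small_def r_def using \<open>2 < p\<close>
    by (intro expectation_sum_truncated_powr_le assms) auto
  have "expectation (\<lambda>\<omega>. \<bar>large \<omega>\<bar> powr p) \<le> 2 powr p"
    unfolding large_def using \<open>2 < p\<close> by (intro expectation_sum_tail_powr_le assms) auto
  also have "\<dots> \<le> (3.4 * r) powr p"
    using \<open>2 \<le> r\<close> \<open>2 < p\<close> by (intro powr_mono2) auto
  finally have large_le: "expectation (\<lambda>\<omega>. \<bar>large \<omega>\<bar> powr p) \<le> (3.4 * r) powr p" .
  have "expectation (\<lambda>\<omega>. \<bar>\<Sum>i\<in>I. X i \<omega>\<bar> powr p)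
      \<le> expectation (\<lambda>\<omega>. 2 powr (p - 1) * (\<bar>small \<omega>\<bar> powr p + \<bar>large \<omega>\<bar> powr p))"
    unfolding sum_split using \<open>2 < p\<close> int_small int_large
    by (intro integral_mono' abs_add_powr_le) auto
  also have "\<dots> = 2 powr (p - 1) * (expectation (\<lambda>\<omega>. \<bar>small \<omega>\<bar> powr p)
      + expectation (\<lambda>\<omega>. \<bar>large \<omega>\<bar> powr p))"
    using int_small int_large by simp
  also have "\<dots> \<le> 2 powr (p - 1) * ((3.4 * r) powr p + (3.4 * r) powr p)"
    by (intro mult_left_mono add_mono small_le large_le) auto
  also have "\<dots> = (6.8 * r) powr p"
    using powr_mult[of 2 "3.4 * r" p] by (simp add: powr_diff)
  finally show ?thesis
    by (simp add: r_def)
qed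

theorem rosenthal:
  assumes "finite I" and indep: "indep_vars (\<lambda>_. borel) X I"
    and sym: "\<And>i. i \<in> I \<Longrightarrow> symmetric_var (X i)"
    and "2 < p" and int: "\<And>i. i \<in> I \<Longrightarrow> integrable M (\<lambda>\<omega>. \<bar>X i \<omega>\<bar> powr p)"
    and "0 \<le> R"
    and moment_le: "(\<Sum>i\<in>I. expectation (\<lambda>\<omega>. \<bar>X i \<omega>\<bar> powr p)) \<le> R powr p"
    and variance_le: "(\<Sum>i\<in>I. expectation (\<lambda>\<omega>. (X i \<omega>)\<^sup>2)) \<le> R\<^sup>2"
  shows "expectation (\<lambda>\<omega>. \<bar>\<Sum>i\<in>I. X i \<omega>\<bar> powr p) \<le> (6.8 * (p / ln p) * R) powr p"
proof (cases "R = 0")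
  case True
  have "(\<Sum>i\<in>I. expectation (\<lambda>\<omega>. \<bar>X i \<omega>\<bar> powr p)) = 0"
    using moment_le True by (intro antisym sum_nonneg) auto
  then have "expectation (\<lambda>\<omega>. \<bar>X i \<omega>\<bar> powr p) = 0" if "i \<in> I" for i
    using that \<open>finite I\<close> by (subst (asm) sum_nonneg_eq_0_iff) auto
  then have "AE \<omega> in M. X i \<omega> = 0" if "i \<in> I" for i
    using that int by (simp add: integral_nonneg_eq_0_iff_AE)
  then have "AE \<omega> in M. \<forall>i\<in>I. X i \<omega> = 0"
    using \<open>finite I\<close> by (simp add: AE_finite_all)
  then have "expectation (\<lambda>\<omega>. \<bar>\<Sum>i\<in>I. X i \<omega>\<bar> powr p) = 0"
    by (intro integral_eq_zero_AE) (auto elim!: eventually_mono)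
  then show ?thesis
    by simp
next
  case False
  with \<open>0 \<le> R\<close> have "0 < R"
    by simp
  have "expectation (\<lambda>\<omega>. \<bar>\<Sum>i\<in>I. X i \<omega> / R\<bar> powr p) \<le> (6.8 * (p / ln p)) powr p"
  proof (rule rosenthal_normalized[OF \<open>finite I\<close> indep_vars_compose2[OF indep]])
    show "symmetric_var (\<lambda>\<omega>. X i \<omega> / R)" if "i \<in> I" for i
      using sym[OF that] by (rule symmetric_var_odd_comp) auto
    show "(\<Sum>i\<in>I. expectation (\<lambda>\<omega>. \<bar>X i \<omega> / R\<bar> powr p)) \<le> 1"
      using moment_le \<open>0 < R\<close> by (simp add: powr_divide sum_divide_distrib[symmetric])
    show "(\<Sum>i\<in>I. expectation (\<lambda>\<omega>. (X i \<omega> / R)\<^sup>2)) \<le> 1"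
      using variance_le \<open>0 < R\<close> by (simp add: power_divide sum_divide_distrib[symmetric])
  qed (use int \<open>2 < p\<close> in \<open>auto simp: powr_divide\<close>)
  then show ?thesis
    using \<open>0 < R\<close> by (simp add: powr_divide powr_mult pos_divide_le_eq flip: sum_divide_distrib)
qed

end

subsection \<open>Square-integrable functions\<close>

definition square_integrable :: "'a measure \<Rightarrow> ('a \<Rightarrow> real) \<Rightarrow> bool" where
  "square_integrable M f \<longleftrightarrow> f \<in> borel_measurable M \<and> integrable M (\<lambda>x. (f x)\<^sup>2)"

definition L2_norm :: "'a measure \<Rightarrow> ('a \<Rightarrow> real) \<Rightarrow> real" where
  "L2_norm M f = sqrt (\<integral>x. (f x)\<^sup>2 \<partial>M)"

lemma square_integrable_measurable: "square_integrable M f \<Longrightarrow> f \<in> borel_measurable M"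
  by (simp add: square_integrable_def)

lemma L2_norm_nonneg [simp]: "0 \<le> L2_norm M f"
  by (simp add: L2_norm_def)

lemma L2_norm_power2: "(L2_norm M f)\<^sup>2 = (\<integral>x. (f x)\<^sup>2 \<partial>M)"
  by (simp add: L2_norm_def)

lemma integral_mult_self: "(\<integral>x. f x * f x \<partial>M) = (L2_norm M f)\<^sup>2"
  unfolding L2_norm_power2 by (simp add: power2_eq_square)

lemma L2_norm_minus_commute: "L2_norm M (\<lambda>x. f x - g x) = L2_norm M (\<lambda>x. g x - f x)"
  by (simp add: L2_norm_def power2_commute)

lemma L2_norm_scale: "L2_norm M (\<lambda>x. c * f x) = \<bar>c\<bar> * L2_norm M f"
  by (simp add: L2_norm_def power_mult_distrib real_sqrt_mult)

lemma abs_mult_le_sum_squares: "\<bar>a * b\<bar> \<le> a\<^sup>2 + b\<^sup>2" for a b :: real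
  using sum_squares_bound[of "\<bar>a\<bar>" "\<bar>b\<bar>"] abs_ge_zero[of "a * b"]
  unfolding abs_mult power2_abs by linarith

lemma integrable_mult_square_integrable:
  assumes "square_integrable M f" "square_integrable M g"
  shows "integrable M (\<lambda>x. f x * g x)"
proof (rule Bochner_Integration.integrable_bound)
  show "integrable M (\<lambda>x. (f x)\<^sup>2 + (g x)\<^sup>2)"
    using assms by (simp add: square_integrable_def)
  show "AE x in M. norm (f x * g x) \<le> norm ((f x)\<^sup>2 + (g x)\<^sup>2)"
    using abs_mult_le_sum_squares by simp
qed (use assms in \<open>auto simp: square_integrable_def\<close>)

lemma square_integrable_scale: "square_integrable M f \<Longrightarrow> square_integrable M (\<lambda>x. c * f x)"
  by (auto simp: square_integrable_def power_mult_distrib)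

lemma square_integrable_add:
  assumes "square_integrable M f" "square_integrable M g"
  shows "square_integrable M (\<lambda>x. f x + g x)"
  using assms integrable_mult_square_integrable[OF assms]
  by (auto simp: square_integrable_def power2_sum mult.assoc)

lemma square_integrable_diff:
  "square_integrable M f \<Longrightarrow> square_integrable M g \<Longrightarrow> square_integrable M (\<lambda>x. f x - g x)"
  using square_integrable_add[of M f "\<lambda>x. - 1 * g x"] square_integrable_scale[of M g "- 1"] by simp

lemma square_integrable_sum:
  assumes "\<And>i. i \<in> I \<Longrightarrow> square_integrable M (f i)"
  shows "square_integrable M (\<lambda>x. \<Sum>i\<in>I. f i x)"
  using assms
proof (induction I rule: infinite_finite_induct)
  case (insert i I)
  then show ?case
    by (simp add: square_integrable_add)
qed (auto simp: square_integrable_def)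

lemma L2_norm_add_power2:
  assumes "square_integrable M f" "square_integrable M g"
  shows "(L2_norm M (\<lambda>x. f x + g x))\<^sup>2 = (L2_norm M f)\<^sup>2 + 2 * (\<integral>x. f x * g x \<partial>M) + (L2_norm M g)\<^sup>2"
  using assms integrable_mult_square_integrable[OF assms]
  by (simp add: L2_norm_power2 power2_sum mult.assoc square_integrable_def)

lemma L2_norm_diff_power2:
  assumes "square_integrable M f" "square_integrable M g"
  shows "(L2_norm M (\<lambda>x. f x - g x))\<^sup>2 = (L2_norm M f)\<^sup>2 - 2 * (\<integral>x. f x * g x \<partial>M) + (L2_norm M g)\<^sup>2"
  using L2_norm_add_power2[OF assms(1) square_integrable_scale[OF assms(2), of "- 1"]]
    L2_norm_scale[of M "- 1" g]
  by simp

lemma L2_norm_cong_AE: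
  assumes "f \<in> borel_measurable M" "g \<in> borel_measurable M" "AE x in M. f x = g x"
  shows "L2_norm M f = L2_norm M g"
  unfolding L2_norm_def using assms by (intro arg_cong[where f = sqrt] integral_cong_AE) auto

lemma L2_norm_eq_0_AE:
  assumes "square_integrable M f" "L2_norm M f = 0"
  shows "AE x in M. f x = 0"
proof -
  have "AE x in M. (f x)\<^sup>2 = 0"
    using assms
    by (subst integral_nonneg_eq_0_iff_AE[symmetric]) (auto simp: square_integrable_def L2_norm_def)
  then show ?thesis
    by simp
qed

lemma L2_Cauchy_Schwarz:
  assumes f: "square_integrable M f" and g: "square_integrable M g"
  shows "\<bar>\<integral>x. f x * g x \<partial>M\<bar> \<le> L2_norm M f * L2_norm M g"
proof -
  let ?I = "\<integral>x. \<bar>f x * g x\<bar> \<partial>M"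
  have [measurable]: "f \<in> borel_measurable M" "g \<in> borel_measurable M"
    using f g by (simp_all add: square_integrable_measurable)
  have square: "(\<integral>\<^sup>+x. (ennreal \<bar>h x\<bar>)\<^sup>2 \<partial>M) = ennreal ((L2_norm M h)\<^sup>2)" if "square_integrable M h" for h
    using that by (simp add: square_integrable_def L2_norm_power2 ennreal_power nn_integral_eq_integral)
  have "ennreal (?I\<^sup>2) = (\<integral>\<^sup>+x. ennreal \<bar>f x\<bar> * ennreal \<bar>g x\<bar> \<partial>M)\<^sup>2"
    using integrable_mult_square_integrable[OF f g]
    by (simp add: nn_integral_eq_integral ennreal_power flip: ennreal_mult'' abs_mult)
  also have "\<dots> \<le> (\<integral>\<^sup>+x. (ennreal \<bar>f x\<bar>)\<^sup>2 \<partial>M) * (\<integral>\<^sup>+x. (ennreal \<bar>g x\<bar>)\<^sup>2 \<partial>M)"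
    by (intro Cauchy_Schwarz_nn_integral) measurable
  also have "\<dots> = ennreal ((L2_norm M f * L2_norm M g)\<^sup>2)"
    by (simp add: square f g ennreal_mult power_mult_distrib)
  finally have "?I \<le> L2_norm M f * L2_norm M g"
    by (auto intro: power2_le_imp_le)
  then show ?thesis
    using integral_abs_bound[of M "\<lambda>x. f x * g x"] by linarith
qed

lemma L2_norm_triangle:
  assumes f: "square_integrable M f" and g: "square_integrable M g"
  shows "L2_norm M (\<lambda>x. f x + g x) \<le> L2_norm M f + L2_norm M g"
proof (rule power2_le_imp_le)
  show "(L2_norm M (\<lambda>x. f x + g x))\<^sup>2 \<le> (L2_norm M f + L2_norm M g)\<^sup>2"
    using L2_Cauchy_Schwarz[OF f g] by (simp add: L2_norm_add_power2[OF f g] power2_sum)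
qed simp

lemma L2_norm_diff_triangle:
  assumes "square_integrable M f" "square_integrable M g" "square_integrable M h"
  shows "L2_norm M (\<lambda>x. f x - h x) \<le> L2_norm M (\<lambda>x. f x - g x) + L2_norm M (\<lambda>x. g x - h x)"
  using L2_norm_triangle[of M "\<lambda>x. f x - g x" "\<lambda>x. g x - h x"] assms
  by (simp add: square_integrable_diff)

lemma tendsto_integral_mult_L2:
  assumes u: "\<And>n. square_integrable M (u n)"
    and g: "square_integrable M g" and h: "square_integrable M h"
    and lim: "(\<lambda>n. L2_norm M (\<lambda>x. u n x - g x)) \<longlonglongrightarrow> 0"
  shows "(\<lambda>n. \<integral>x. u n x * h x \<partial>M) \<longlonglongrightarrow> (\<integral>x. g x * h x \<partial>M)"
proof (rule LIM_zero_cancel[OF Lim_null_comparison])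
  show "(\<lambda>n. L2_norm M (\<lambda>x. u n x - g x) * L2_norm M h) \<longlonglongrightarrow> 0"
    using lim by (rule tendsto_mult_left_zero)
  show "\<forall>\<^sub>F n in sequentially. norm ((\<integral>x. u n x * h x \<partial>M) - (\<integral>x. g x * h x \<partial>M))
      \<le> L2_norm M (\<lambda>x. u n x - g x) * L2_norm M h"
    using L2_Cauchy_Schwarz[OF square_integrable_diff[OF u g] h]
      integrable_mult_square_integrable[OF u h]
      integrable_mult_square_integrable[OF g h]
    by (intro always_eventually) (simp add: left_diff_distrib)
qed

lemma L2_tendsto_0_AE_subseq:
  assumes "\<And>n. square_integrable M (u n)" and "(\<lambda>n. L2_norm M (u n)) \<longlonglongrightarrow> 0"
  obtains r where "strict_mono r" "AE x in M. (\<lambda>k. u (r k) x) \<longlonglongrightarrow> 0"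
proof -
  have "(\<lambda>n. \<integral>x. norm ((u n x)\<^sup>2) \<partial>M) \<longlonglongrightarrow> 0"
    using tendsto_power[OF assms(2), of 2] by (simp add: L2_norm_power2)
  then obtain r where mono: "strict_mono r" and lim: "AE x in M. (\<lambda>k. (u (r k) x)\<^sup>2) \<longlonglongrightarrow> 0"
    using tendsto_L1_AE_subseq[of M "\<lambda>n x. (u n x)\<^sup>2"] assms(1) by (auto simp: square_integrable_def)
  have "AE x in M. (\<lambda>k. u (r k) x) \<longlonglongrightarrow> 0"
    using lim
  proof eventually_elim
    case (elim x)
    from tendsto_real_sqrt[OF this] show ?case
      by (simp add: tendsto_rabs_zero_iff)
  qed
  with mono show ?thesis
    by (rule that)
qed

lemma integral_le_of_tendsto_AE:
  fixes u :: "nat \<Rightarrow> 'a \<Rightarrow> real"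
  assumes int: "\<And>k. integrable M (u k)" and nonneg: "\<And>k x. 0 \<le> u k x"
    and [measurable]: "v \<in> borel_measurable M" and lim: "AE x in M. (\<lambda>k. u k x) \<longlonglongrightarrow> v x"
    and le: "\<And>k. (\<integral>x. u k x \<partial>M) \<le> B"
  shows "integrable M v" and "(\<integral>x. v x \<partial>M) \<le> B"
proof -
  have "0 \<le> B"
    by (rule order_trans[OF _ le[of 0]]) (simp add: nonneg)
  have v_nonneg: "AE x in M. 0 \<le> v x"
    using lim by eventually_elim (auto intro: LIMSEQ_le_const nonneg)
  have "(\<integral>\<^sup>+x. ennreal (v x) \<partial>M) = (\<integral>\<^sup>+x. liminf (\<lambda>k. ennreal (u k x)) \<partial>M)"
    using lim by (intro nn_integral_cong_AE, eventually_elim)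
      (auto intro!: lim_imp_Liminf[symmetric] tendsto_ennrealI)
  also have "\<dots> \<le> liminf (\<lambda>k. \<integral>\<^sup>+x. ennreal (u k x) \<partial>M)"
    using int by (intro nn_integral_liminf) auto
  also have "\<dots> \<le> ennreal B"
    using le int nonneg by (intro Liminf_le) (auto simp: nn_integral_eq_integral ennreal_leI)
  finally have nn_le: "(\<integral>\<^sup>+x. ennreal (v x) \<partial>M) \<le> ennreal B" .
  then show "integrable M v"
    using v_nonneg by (intro integrableI_nonneg) (auto intro: le_less_trans)
  then show "(\<integral>x. v x \<partial>M) \<le> B"
    using nn_le \<open>0 \<le> B\<close> v_nonneg by (simp add: nn_integral_eq_integral)
qed

lemma L2_norm_le_of_tendsto_AE:
  assumes u: "\<And>k. square_integrable M (u k)" and "v \<in> borel_measurable M"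
    and lim: "AE x in M. (\<lambda>k. u k x) \<longlonglongrightarrow> v x"
    and le: "\<And>k. L2_norm M (u k) \<le> B"
  shows "square_integrable M v" and "L2_norm M v \<le> B"
proof -
  have "0 \<le> B"
    using order_trans[OF L2_norm_nonneg le] .
  have "(\<integral>x. (u k x)\<^sup>2 \<partial>M) \<le> B\<^sup>2" for k
    using power_mono[OF le[of k], of 2] by (simp add: L2_norm_power2)
  moreover have "AE x in M. (\<lambda>k. (u k x)\<^sup>2) \<longlonglongrightarrow> (v x)\<^sup>2"
    using lim by eventually_elim (intro tendsto_power)
  ultimately have "integrable M (\<lambda>x. (v x)\<^sup>2)" and "(\<integral>x. (v x)\<^sup>2 \<partial>M) \<le> B\<^sup>2"
    using integral_le_of_tendsto_AE[of M "\<lambda>k x. (u k x)\<^sup>2" "\<lambda>x. (v x)\<^sup>2" "B\<^sup>2"] u assms(2)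
    by (auto simp: square_integrable_def)
  then show "square_integrable M v" "L2_norm M v \<le> B"
    using assms(2) \<open>0 \<le> B\<close> by (auto simp: square_integrable_def L2_norm_def real_le_lsqrt)
qed

lemma abs_le_half_power_add_square: "\<bar>a\<bar> \<le> (1 / 2) ^ k + 2 ^ k * a\<^sup>2" for a :: real
proof -
  have "2 ^ k * \<bar>a\<bar> \<le> 2 ^ k * ((1 / 2) ^ k + 2 ^ k * a\<^sup>2)"
    using abs_mult_le_sum_squares[of 1 "2 ^ k * a"]
    by (simp add: abs_mult power2_eq_square power_divide algebra_simps)
  then show ?thesis
    by simp
qed

text \<open>Since \<open>M\<close> may be infinite, \<open>\<bar>d\<^sub>k\<bar>\<close> is not compared with an integrable function but with
  \<open>2\<^bsup>-k\<^esup> + 2\<^bsup>k\<^esup> d\<^sub>k\<^sup>2\<close>.\<close>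

lemma AE_summable_of_L2_norm_le:
  assumes d: "\<And>k. square_integrable M (d k)" and le: "\<And>k. L2_norm M (d k) \<le> (1 / 2) ^ k"
  shows "AE x in M. summable (\<lambda>k. d k x)"
proof -
  have [measurable]: "d k \<in> borel_measurable M" for k
    using d by (rule square_integrable_measurable)
  have int_le: "(\<integral>\<^sup>+x. ennreal (2 ^ k * (d k x)\<^sup>2) \<partial>M) \<le> ennreal ((1 / 2) ^ k)" for k
  proof -
    have "(\<integral>\<^sup>+x. ennreal (2 ^ k * (d k x)\<^sup>2) \<partial>M) = ennreal (2 ^ k * (L2_norm M (d k))\<^sup>2)"
      using d by (simp add: nn_integral_eq_integral L2_norm_power2 square_integrable_def)
    also have "\<dots> \<le> ennreal (2 ^ k * ((1 / 2) ^ k)\<^sup>2)"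
      using le by (intro ennreal_leI mult_left_mono power_mono) auto
    also have "2 ^ k * ((1 / 2) ^ k)\<^sup>2 = (1 / 2 :: real) ^ k"
      by (simp add: power2_eq_square power_divide)
    finally show ?thesis .
  qed
  have "(\<integral>\<^sup>+x. (\<Sum>k. ennreal (2 ^ k * (d k x)\<^sup>2)) \<partial>M) = (\<Sum>k. \<integral>\<^sup>+x. ennreal (2 ^ k * (d k x)\<^sup>2) \<partial>M)"
    by (intro nn_integral_suminf) measurable
  also have "\<dots> \<le> (\<Sum>k. ennreal ((1 / 2) ^ k))"
    using int_le by (intro suminf_le) auto
  also have "\<dots> < \<infinity>"
    by (subst suminf_ennreal2) (auto intro: summable_geometric)
  finally have "AE x in M. (\<Sum>k. ennreal (2 ^ k * (d k x)\<^sup>2)) \<noteq> \<infinity>"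
    by (intro nn_integral_PInf_AE) auto
  then show ?thesis
  proof eventually_elim
    case (elim x)
    then have "summable (\<lambda>k. 2 ^ k * (d k x)\<^sup>2)"
      by (intro summable_suminf_not_top) auto
    then have "summable (\<lambda>k. (1 / 2) ^ k + 2 ^ k * (d k x)\<^sup>2)"
      by (intro summable_add summable_geometric) auto
    moreover have "norm (d k x) \<le> (1 / 2) ^ k + 2 ^ k * (d k x)\<^sup>2" for k
      using abs_le_half_power_add_square by simp
    ultimately show ?case
      by (rule summable_comparison_test'[where N = 0])
  qed
qed

lemma L2_Cauchy_AE_subseq:
  fixes s :: "nat \<Rightarrow> 'a \<Rightarrow> real"
  assumes s: "\<And>n. square_integrable M (s n)"
    and cauchy: "\<And>e. 0 < e \<Longrightarrow> \<exists>N. \<forall>i\<ge>N. \<forall>j\<ge>N. L2_norm M (\<lambda>x. s i x - s j x) < e"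
  obtains g r where "g \<in> borel_measurable M" "strict_mono r" "AE x in M. (\<lambda>k. s (r k) x) \<longlonglongrightarrow> g x"
proof -
  have [measurable]: "s n \<in> borel_measurable M" for n
    using s by (rule square_integrable_measurable)
  have "\<exists>r. \<forall>k. (\<forall>i\<ge>r k. \<forall>j\<ge>r k. L2_norm M (\<lambda>x. s i x - s j x) < (1 / 2) ^ k) \<and> r k < r (Suc k)"
  proof (rule dependent_nat_choice)
    show "\<exists>N. \<forall>i\<ge>N. \<forall>j\<ge>N. L2_norm M (\<lambda>x. s i x - s j x) < (1 / 2) ^ 0"
      using cauchy[of 1] by simp
    fix m k
    obtain N where "\<forall>i\<ge>N. \<forall>j\<ge>N. L2_norm M (\<lambda>x. s i x - s j x) < (1 / 2) ^ Suc k"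
      using cauchy[of "(1 / 2) ^ Suc k"] by auto
    then show "\<exists>N'. (\<forall>i\<ge>N'. \<forall>j\<ge>N'. L2_norm M (\<lambda>x. s i x - s j x) < (1 / 2) ^ Suc k) \<and> m < N'"
      by (intro exI[of _ "max N (Suc m)"]) auto
  qed
  then obtain r where r: "\<And>k i j. r k \<le> i \<Longrightarrow> r k \<le> j \<Longrightarrow> L2_norm M (\<lambda>x. s i x - s j x) < (1 / 2) ^ k"
    and mono: "strict_mono r"
    by (auto simp: strict_mono_Suc_iff)
  define g where "g x = s (r 0) x + (\<Sum>k. s (r (Suc k)) x - s (r k) x)" for x
  have g_measurable: "g \<in> borel_measurable M"
    unfolding g_def by measurable
  have "AE x in M. summable (\<lambda>k. s (r (Suc k)) x - s (r k) x)"
    using s strict_monoD[OF mono]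
    by (intro AE_summable_of_L2_norm_le square_integrable_diff less_imp_le[OF r])
      (auto simp: less_imp_le)
  then have "AE x in M. (\<lambda>k. s (r k) x) \<longlonglongrightarrow> g x"
  proof eventually_elim
    case (elim x)
    from tendsto_add[OF tendsto_const summable_LIMSEQ[OF this], of "s (r 0) x"] show ?case
      unfolding g_def sum_lessThan_telescope[of "\<lambda>k. s (r k) x"] by simp
  qed
  with g_measurable mono show ?thesis
    by (rule that)
qed

lemma L2_complete:
  fixes s :: "nat \<Rightarrow> 'a \<Rightarrow> real"
  assumes s: "\<And>n. square_integrable M (s n)"
    and cauchy: "\<And>e. 0 < e \<Longrightarrow> \<exists>N. \<forall>i\<ge>N. \<forall>j\<ge>N. L2_norm M (\<lambda>x. s i x - s j x) < e"
  obtains g where "square_integrable M g" "(\<lambda>n. L2_norm M (\<lambda>x. s n x - g x)) \<longlonglongrightarrow> 0"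
proof -
  obtain g r where [measurable]: "g \<in> borel_measurable M"
    and mono: "strict_mono r" and lim: "AE x in M. (\<lambda>k. s (r k) x) \<longlonglongrightarrow> g x"
    by (rule L2_Cauchy_AE_subseq[OF s cauchy])
  have [measurable]: "s n \<in> borel_measurable M" for n
    using s by (rule square_integrable_measurable)
  have limit_close: "square_integrable M (\<lambda>x. s n x - g x) \<and> L2_norm M (\<lambda>x. s n x - g x) \<le> e"
    if N: "\<forall>i\<ge>N. \<forall>j\<ge>N. L2_norm M (\<lambda>x. s i x - s j x) < e" and "N \<le> n" for e N n
  proof -
    have "N \<le> r (k + N)" for k
      using seq_suble[OF mono, of "k + N"] by simp
    then have "L2_norm M (\<lambda>x. s n x - s (r (k + N)) x) \<le> e" for k
      using N \<open>N \<le> n\<close> by (simp add: less_imp_le)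
    moreover have "AE x in M. (\<lambda>k. s n x - s (r (k + N)) x) \<longlonglongrightarrow> s n x - g x"
      using lim by eventually_elim (intro tendsto_diff tendsto_const LIMSEQ_ignore_initial_segment)
    ultimately show ?thesis
      using L2_norm_le_of_tendsto_AE[of M "\<lambda>k x. s n x - s (r (k + N)) x" "\<lambda>x. s n x - g x" e] s
      by (simp add: square_integrable_diff)
  qed
  obtain N where "\<forall>i\<ge>N. \<forall>j\<ge>N. L2_norm M (\<lambda>x. s i x - s j x) < 1"
    using cauchy[of 1] by auto
  with limit_close have "square_integrable M (\<lambda>x. s N x - g x)"
    by blast
  from square_integrable_diff[OF s[of N] this] have "square_integrable M g"
    by simp
  moreover have "(\<lambda>n. L2_norm M (\<lambda>x. s n x - g x)) \<longlonglongrightarrow> 0"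
  proof (rule LIMSEQ_I)
    fix e :: real assume "0 < e"
    then obtain N where "\<forall>i\<ge>N. \<forall>j\<ge>N. L2_norm M (\<lambda>x. s i x - s j x) < e / 2"
      using cauchy[of "e / 2"] by auto
    with limit_close \<open>0 < e\<close> show "\<exists>N. \<forall>n\<ge>N. norm (L2_norm M (\<lambda>x. s n x - g x) - 0) < e"
      by (intro exI[of _ N]) fastforce
  qed
  ultimately show ?thesis
    by (rule that)
qed

subsection \<open>Orthogonal series\<close>

locale orthogonal_sequence =
  fixes M :: "'a measure" and f :: "nat \<Rightarrow> 'a \<Rightarrow> real"
  assumes f_L2: "square_integrable M (f n)"
    and orthogonal: "i \<noteq> j \<Longrightarrow> (\<integral>x. f i x * f j x \<partial>M) = 0"
    and f_nonzero: "0 < L2_norm M (f n)"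
begin

definition weight :: "nat \<Rightarrow> real" where
  "weight n = (L2_norm M (f n))\<^sup>2"

definition combination :: "(nat \<Rightarrow> real) \<Rightarrow> nat set \<Rightarrow> 'a \<Rightarrow> real" where
  "combination c A x = (\<Sum>n\<in>A. c n * f n x)"

definition coefficient :: "('a \<Rightarrow> real) \<Rightarrow> nat \<Rightarrow> real" where
  "coefficient g n = (\<integral>x. g x * f n x \<partial>M) / weight n"

lemma weight_pos: "0 < weight n"
  using f_nonzero[of n] by (simp add: weight_def)

lemma combination_L2: "square_integrable M (combination c A)"
  unfolding combination_def by (intro square_integrable_sum square_integrable_scale f_L2)

lemma combination_linear:
  "combination (\<lambda>n. a * c n + b * d n) A x = a * combination c A x + b * combination d A x"
  by (simp add: combination_def sum.distrib sum_distrib_left algebra_simps)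

lemma coefficient_linear:
  assumes "square_integrable M g" "square_integrable M h"
  shows "coefficient (\<lambda>x. a * g x + b * h x) = (\<lambda>n. a * coefficient g n + b * coefficient h n)"
proof
  fix n
  have "(\<integral>x. (a * g x + b * h x) * f n x \<partial>M) = (\<integral>x. a * (g x * f n x) + b * (h x * f n x) \<partial>M)"
    by (simp add: algebra_simps)
  also have "\<dots> = a * (\<integral>x. g x * f n x \<partial>M) + b * (\<integral>x. h x * f n x \<partial>M)"
    using assms by (simp add: integrable_mult_square_integrable f_L2)
  finally show "coefficient (\<lambda>x. a * g x + b * h x) n = a * coefficient g n + b * coefficient h n"
    by (simp add: coefficient_def add_divide_distrib)
qed

lemma coefficient_cong_AE:
  assumes "g \<in> borel_measurable M" "h \<in> borel_measurable M" "AE x in M. g x = h x"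
  shows "coefficient g = coefficient h"
proof
  fix n
  have "(\<integral>x. g x * f n x \<partial>M) = (\<integral>x. h x * f n x \<partial>M)"
    using assms square_integrable_measurable[OF f_L2] by (intro integral_cong_AE) auto
  then show "coefficient g n = coefficient h n"
    by (simp add: coefficient_def)
qed

lemma integral_mult_combination:
  assumes "square_integrable M g"
  shows "(\<integral>x. g x * combination c A x \<partial>M) = (\<Sum>n\<in>A. c n * coefficient g n * weight n)"
proof -
  have "(\<integral>x. g x * combination c A x \<partial>M) = (\<integral>x. (\<Sum>n\<in>A. c n * (g x * f n x)) \<partial>M)"
    by (simp add: combination_def sum_distrib_left mult.left_commute)
  also have "\<dots> = (\<Sum>n\<in>A. c n * (\<integral>x. g x * f n x \<partial>M))"
    using assms by (simp add: integrable_mult_square_integrable f_L2)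
  also have "\<dots> = (\<Sum>n\<in>A. c n * coefficient g n * weight n)"
    using weight_pos by (simp add: coefficient_def less_imp_neq[symmetric])
  finally show ?thesis .
qed

lemma coefficient_f: "coefficient (f n) k = (if k = n then 1 else 0)"
  using weight_pos[of n] orthogonal[of n k]
  by (auto simp: coefficient_def weight_def integral_mult_self)

lemma coefficient_combination:
  assumes "finite A"
  shows "coefficient (combination c A) n = (if n \<in> A then c n else 0)"
proof -
  have "(\<integral>x. combination c A x * f n x \<partial>M) = (\<Sum>k\<in>A. c k * coefficient (f n) k * weight k)"
    using integral_mult_combination[OF f_L2] by (simp add: mult.commute)
  also have "\<dots> = (if n \<in> A then c n * weight n else 0)"
    using assms by (simp add: coefficient_f if_distrib if_distribR cong: if_cong)
  finally show ?thesis
    using weight_pos[of n] by (simp add: coefficient_def)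
qed

lemma L2_norm_combination:
  assumes "finite A"
  shows "(L2_norm M (combination c A))\<^sup>2 = (\<Sum>n\<in>A. (c n)\<^sup>2 * weight n)"
  using integral_mult_combination[OF combination_L2, of c A c A] assms
  by (simp add: integral_mult_self coefficient_combination power2_eq_square)

lemma bessel:
  assumes "finite A" and g: "square_integrable M g"
  shows "(\<Sum>n\<in>A. (coefficient g n)\<^sup>2 * weight n) \<le> (L2_norm M g)\<^sup>2"
proof -
  have "0 \<le> (L2_norm M (\<lambda>x. g x - combination (coefficient g) A x))\<^sup>2"
    by simp
  also have "\<dots> = (L2_norm M g)\<^sup>2 - (\<Sum>n\<in>A. (coefficient g n)\<^sup>2 * weight n)"
    using assms(1)
    by (simp add: L2_norm_diff_power2 combination_L2 g integral_mult_combination L2_norm_combination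
        flip: power2_eq_square)
  finally show ?thesis
    by simp
qed

lemma summable_coefficient:
  assumes "square_integrable M g"
  shows "summable (\<lambda>n. (coefficient g n)\<^sup>2 * weight n)"
  using bessel[OF _ assms] weight_pos
  by (intro summableI_nonneg_bounded[where x = "(L2_norm M g)\<^sup>2"]) (auto simp: less_imp_le)

definition L2_sums :: "(nat \<Rightarrow> real) \<Rightarrow> ('a \<Rightarrow> real) \<Rightarrow> bool" where
  "L2_sums c g \<longleftrightarrow> square_integrable M g \<and> (\<lambda>N. L2_norm M (\<lambda>x. combination c {..<N} x - g x)) \<longlonglongrightarrow> 0"

lemma L2_sums_square_integrable: "L2_sums c g \<Longrightarrow> square_integrable M g"
  by (simp add: L2_sums_def)

lemma L2_sums_unique:
  assumes g: "L2_sums c g" and h: "L2_sums c h"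
  shows "AE x in M. g x = h x"
proof -
  have L2: "square_integrable M g" "square_integrable M h"
    using g h by (simp_all add: L2_sums_def)
  let ?bound = "\<lambda>N. L2_norm M (\<lambda>x. g x - combination c {..<N} x)
      + L2_norm M (\<lambda>x. combination c {..<N} x - h x)"
  have "?bound \<longlonglongrightarrow> 0 + 0"
    using g h unfolding L2_sums_def L2_norm_minus_commute[of M g] by (intro tendsto_add) auto
  moreover have "L2_norm M (\<lambda>x. g x - h x) \<le> ?bound N" for N
    by (intro L2_norm_diff_triangle combination_L2 L2)
  ultimately have "L2_norm M (\<lambda>x. g x - h x) \<le> 0"
    using LIMSEQ_le_const by fastforce
  then show ?thesis
    using L2_norm_eq_0_AE[OF square_integrable_diff[OF L2]] by (simp add: antisym)
qed

lemma L2_sums_linear: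
  assumes g: "L2_sums c g" and h: "L2_sums d h"
  shows "L2_sums (\<lambda>n. a * c n + b * d n) (\<lambda>x. a * g x + b * h x)"
proof -
  have L2: "square_integrable M g" "square_integrable M h"
    using g h by (simp_all add: L2_sums_def)
  let ?u = "\<lambda>N x. combination (\<lambda>n. a * c n + b * d n) {..<N} x - (a * g x + b * h x)"
  let ?bound = "\<lambda>N. \<bar>a\<bar> * L2_norm M (\<lambda>x. combination c {..<N} x - g x)
      + \<bar>b\<bar> * L2_norm M (\<lambda>x. combination d {..<N} x - h x)"
  have "?u N = (\<lambda>x. a * (combination c {..<N} x - g x) + b * (combination d {..<N} x - h x))" for N
    by (simp add: combination_linear algebra_simps fun_eq_iff)
  then have "L2_norm M (?u N) \<le> ?bound N" for N
    unfolding L2_norm_scale[symmetric]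
    by (simp only:)
      (intro L2_norm_triangle square_integrable_scale square_integrable_diff combination_L2 L2)
  moreover have "?bound \<longlonglongrightarrow> \<bar>a\<bar> * 0 + \<bar>b\<bar> * 0"
    using g h unfolding L2_sums_def by (intro tendsto_intros) auto
  ultimately have "(\<lambda>N. L2_norm M (?u N)) \<longlonglongrightarrow> 0"
    by (intro tendsto_sandwich[of "\<lambda>_. 0" "\<lambda>N. L2_norm M (?u N)"]) auto
  then show ?thesis
    using L2 by (simp add: L2_sums_def square_integrable_add square_integrable_scale)
qed

lemma parseval:
  assumes g: "L2_sums c g" and h: "square_integrable M h"
  shows "(\<lambda>n. c n * coefficient h n * weight n) sums (\<integral>x. g x * h x \<partial>M)"
proof -
  have "(\<lambda>N. \<integral>x. combination c {..<N} x * h x \<partial>M) \<longlonglongrightarrow> (\<integral>x. g x * h x \<partial>M)"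
    using g by (intro tendsto_integral_mult_L2 combination_L2 h) (auto simp: L2_sums_def)
  then show ?thesis
    using integral_mult_combination[OF h, of c] by (simp add: sums_def mult.commute)
qed

lemma coefficient_L2_sums:
  assumes "L2_sums c g"
  shows "coefficient g = c"
proof
  fix n
  have "(\<lambda>k. c k * coefficient (f n) k * weight k) sums (c n * coefficient (f n) n * weight n)"
    using sums_finite[of "{n}" "\<lambda>k. c k * coefficient (f n) k * weight k"] by (simp add: coefficient_f)
  then have "(\<integral>x. g x * f n x \<partial>M) = c n * coefficient (f n) n * weight n"
    using parseval[OF assms f_L2] sums_unique2 by blast
  then show "coefficient g n = c n"
    using weight_pos[of n] by (simp add: coefficient_def[of g] coefficient_f)
qed

lemma L2_norm_combination_diff:
  assumes "i \<le> j"
  shows "(L2_norm M (\<lambda>x. combination c {..<j} x - combination c {..<i} x))\<^sup>2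
    = (\<Sum>n=i..<j. (c n)\<^sup>2 * weight n)"
proof -
  have "combination c {..<j} x - combination c {..<i} x = combination c {i..<j} x" for x
    using sum.atLeastLessThan_concat[of 0 i j "\<lambda>n. c n * f n x"] assms
    by (simp add: combination_def atLeast0LessThan)
  then show ?thesis
    by (simp add: L2_norm_combination)
qed

lemma L2_sums_exists:
  assumes "summable (\<lambda>n. (c n)\<^sup>2 * weight n)"
  shows "\<exists>g. L2_sums c g"
proof -
  have "\<exists>N. \<forall>i\<ge>N. \<forall>j\<ge>N. L2_norm M (\<lambda>x. combination c {..<i} x - combination c {..<j} x) < e"
    if "0 < e" for e
  proof -
    have "0 < e\<^sup>2"
      using that by simp
    then obtain N where N: "\<And>i j. N \<le> i \<Longrightarrow> norm (\<Sum>n=i..<j. (c n)\<^sup>2 * weight n) < e\<^sup>2"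
      using assms unfolding summable_Cauchy by blast
    have close: "L2_norm M (\<lambda>x. combination c {..<j} x - combination c {..<i} x) < e" if "N \<le> i" "i \<le> j"
      for i j
    proof (rule power2_less_imp_less)
      show "(L2_norm M (\<lambda>x. combination c {..<j} x - combination c {..<i} x))\<^sup>2 < e\<^sup>2"
        unfolding L2_norm_combination_diff[OF that(2)] using N[OF that(1), of j]
        by (simp only: real_norm_def abs_less_iff)
    qed (use \<open>0 < e\<close> in simp)
    then have "L2_norm M (\<lambda>x. combination c {..<i} x - combination c {..<j} x) < e" if "N \<le> i" "N \<le> j"
      for i j
      using that by (metis L2_norm_minus_commute nle_le)
    then show ?thesis
      by blast
  qed
  then obtain g where "square_integrable M g" "(\<lambda>N. L2_norm M (\<lambda>x. combination c {..<N} x - g x)) \<longlonglongrightarrow> 0"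
    by (rule L2_complete[OF combination_L2])
  then show ?thesis
    unfolding L2_sums_def by blast
qed

definition series :: "(nat \<Rightarrow> real) \<Rightarrow> 'a \<Rightarrow> real" where
  "series c = (SOME g. L2_sums c g)"

lemma L2_sums_series: "summable (\<lambda>n. (c n)\<^sup>2 * weight n) \<Longrightarrow> L2_sums c (series c)"
  using someI_ex[OF L2_sums_exists] by (simp only: series_def)

definition projection :: "('a \<Rightarrow> real) \<Rightarrow> 'a \<Rightarrow> real" where
  "projection g = series (coefficient g)"

lemma L2_sums_projection: "square_integrable M g \<Longrightarrow> L2_sums (coefficient g) (projection g)"
  unfolding projection_def by (intro L2_sums_series summable_coefficient)

lemma projection_series: "summable (\<lambda>n. (c n)\<^sup>2 * weight n) \<Longrightarrow> projection (series c) = series c"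
  unfolding projection_def by (simp add: coefficient_L2_sums[OF L2_sums_series])

lemma projection_idem: "square_integrable M g \<Longrightarrow> projection (projection g) = projection g"
  unfolding projection_def[of g] by (intro projection_series summable_coefficient)

lemma projection_cong_AE:
  "square_integrable M g \<Longrightarrow> square_integrable M h \<Longrightarrow> AE x in M. g x = h x \<Longrightarrow> projection g = projection h"
  using coefficient_cong_AE[of g h] by (simp add: projection_def square_integrable_measurable)

lemma projection_linear:
  assumes g: "square_integrable M g" and h: "square_integrable M h"
  shows "AE x in M. projection (\<lambda>x. a * g x + b * h x) x = a * projection g x + b * projection h x"
proof (rule L2_sums_unique)
  show "L2_sums (\<lambda>n. a * coefficient g n + b * coefficient h n) (projection (\<lambda>x. a * g x + b * h x))"
    using L2_sums_projection[of "\<lambda>x. a * g x + b * h x"] g h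
    by (simp add: coefficient_linear square_integrable_add square_integrable_scale)
  show "L2_sums (\<lambda>n. a * coefficient g n + b * coefficient h n)
    (\<lambda>x. a * projection g x + b * projection h x)"
    by (intro L2_sums_linear L2_sums_projection g h)
qed

lemma projection_self_adjoint:
  assumes g: "square_integrable M g" and h: "square_integrable M h"
  shows "(\<integral>x. projection g x * h x \<partial>M) = (\<integral>x. g x * projection h x \<partial>M)"
proof -
  have "(\<lambda>n. coefficient g n * coefficient h n * weight n) sums (\<integral>x. projection h x * g x \<partial>M)"
    using parseval[OF L2_sums_projection[OF h] g] by (simp add: mult.commute)
  then show ?thesis
    using parseval[OF L2_sums_projection[OF g] h] sums_unique2 by (fastforce simp: mult.commute)
qed

end

subsection \<open>Independent symmetric ternary sequences\<close>

lemma (in prob_space) square_integrable_of_powr: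
  assumes "2 \<le> p" "g \<in> borel_measurable M" "integrable M (\<lambda>x. \<bar>g x\<bar> powr p)"
  shows "square_integrable M g" and "L2_norm M g \<le> expectation (\<lambda>x. \<bar>g x\<bar> powr p) powr (1 / p)"
proof -
  show "square_integrable M g"
    using integrable_abs_powr_mono[of g 2 p] assms
    by (simp add: square_integrable_def power2_eq_abs_powr del: powr_numeral)
  show "L2_norm M g \<le> expectation (\<lambda>x. \<bar>g x\<bar> powr p) powr (1 / p)"
    using expectation_abs_powr_mono[of g 2 p] assms
    by (simp add: L2_norm_def powr_half_sqrt power2_eq_abs_powr del: powr_numeral)
qed

locale symmetric_ternary_sequence = prob_space M for M :: "'a measure" +
  fixes f :: "nat \<Rightarrow> 'a \<Rightarrow> real"
  assumes indep: "indep_vars (\<lambda>_. borel) f UNIV"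
    and symmetric: "symmetric_var (f n)"
    and ternary: "\<omega> \<in> space M \<Longrightarrow> f n \<omega> \<in> {- 1, 0, 1}"
    and nontrivial: "0 < \<P>(\<omega> in M. f n \<omega> \<noteq> 0)"
begin

lemma f_measurable [measurable]: "f n \<in> borel_measurable M"
  by (rule symmetric_var_measurable[OF symmetric])

lemma abs_mult_f_powr:
  assumes "\<omega> \<in> space M"
  shows "\<bar>c * f n \<omega>\<bar> powr q = \<bar>c\<bar> powr q * indicator {\<omega> \<in> space M. f n \<omega> \<noteq> 0} \<omega>"
  using ternary[OF assms, of n] assms by (auto simp: indicator_def)

lemma integrable_abs_mult_f_powr: "integrable M (\<lambda>\<omega>. \<bar>c * f n \<omega>\<bar> powr q)"
  by (subst Bochner_Integration.integrable_cong[OF refl abs_mult_f_powr])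
    (auto intro!: integrable_mult_right integrable_real_indicator simp: emeasure_eq_measure)

lemma expectation_abs_mult_f_powr:
  "expectation (\<lambda>\<omega>. \<bar>c * f n \<omega>\<bar> powr q) = \<bar>c\<bar> powr q * \<P>(\<omega> in M. f n \<omega> \<noteq> 0)"
  by (subst Bochner_Integration.integral_cong[OF refl abs_mult_f_powr]) (auto simp: Int_absorb2)

lemma L2_norm_f: "(L2_norm M (f n))\<^sup>2 = \<P>(\<omega> in M. f n \<omega> \<noteq> 0)"
  using expectation_abs_mult_f_powr[of 1 n 2] by (simp add: L2_norm_power2)

sublocale orthogonal_sequence M f
proof
  fix n
  show "square_integrable M (f n)"
    using square_integrable_of_powr(1)[of 2 "f n"] integrable_abs_mult_f_powr[of 1 n 2] by simp
  have "0 < (L2_norm M (f n))\<^sup>2"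
    using nontrivial by (simp add: L2_norm_f)
  then show "0 < L2_norm M (f n)"
    using L2_norm_nonneg[of M "f n"] by (simp add: less_le)
next
  fix i j :: nat
  assume "i \<noteq> j"
  then have "indep_var borel (f i) borel (f j)"
    using indep_vars_sum[of "{j}" i f] indep_vars_subset[OF indep, of "{i, j}"] by simp
  moreover have "integrable M (f n)" for n
    using integrable_abs_mult_f_powr[of 1 n 1] by (simp add: integrable_abs_iff)
  ultimately show "(\<integral>x. f i x * f j x \<partial>M) = 0"
    by (simp add: indep_var_lebesgue_integral expectation_symmetric_var symmetric)
qed

lemma weight_eq_prob: "weight n = \<P>(\<omega> in M. f n \<omega> \<noteq> 0)"
  by (simp add: weight_def L2_norm_f)

lemma expectation_abs_mult_f_powr_eq_weight:
  "expectation (\<lambda>\<omega>. \<bar>c * f n \<omega>\<bar> powr q) = \<bar>c\<bar> powr q * weight n"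
  by (simp only: expectation_abs_mult_f_powr weight_eq_prob)

lemma indep_vars_mult_f: "indep_vars (\<lambda>_. borel) (\<lambda>n \<omega>. c n * f n \<omega>) A"
  by (rule indep_vars_compose2[OF indep_vars_subset[OF indep]]) auto

lemma symmetric_var_mult_f: "symmetric_var (\<lambda>\<omega>. c * f n \<omega>)"
  by (rule symmetric_var_odd_comp[OF symmetric]) auto

lemma integrable_combination_powr: "1 \<le> q \<Longrightarrow> integrable M (\<lambda>\<omega>. \<bar>combination c A \<omega>\<bar> powr q)"
  unfolding combination_def by (intro integrable_abs_powr_sum integrable_abs_mult_f_powr) auto

lemma expectation_combination_powr_le:
  assumes "finite A" "1 \<le> q" "q \<le> 2"
  shows "expectation (\<lambda>\<omega>. \<bar>combination c A \<omega>\<bar> powr q) \<le> (\<Sum>n\<in>A. \<bar>c n\<bar> powr q * weight n)"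
  unfolding combination_def expectation_abs_mult_f_powr_eq_weight[symmetric]
  using assms
  by (intro expectation_abs_sum_powr_le indep_vars_mult_f symmetric_var_mult_f
      integrable_abs_mult_f_powr)

lemma rosenthal_combination:
  assumes "finite A" "2 < p" "0 \<le> R"
    and "(\<Sum>n\<in>A. \<bar>c n\<bar> powr p * weight n) \<le> R powr p" and "(\<Sum>n\<in>A. (c n)\<^sup>2 * weight n) \<le> R\<^sup>2"
  shows "expectation (\<lambda>\<omega>. \<bar>combination c A \<omega>\<bar> powr p) \<le> (6.8 * (p / ln p) * R) powr p"
  unfolding combination_def
proof (rule rosenthal[OF \<open>finite A\<close> indep_vars_mult_f symmetric_var_mult_f
    \<open>2 < p\<close> integrable_abs_mult_f_powr \<open>0 \<le> R\<close>])
  show "(\<Sum>n\<in>A. expectation (\<lambda>\<omega>. \<bar>c n * f n \<omega>\<bar> powr p)) \<le> R powr p"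
    using assms(4) by (simp only: expectation_abs_mult_f_powr_eq_weight)
  show "(\<Sum>n\<in>A. expectation (\<lambda>\<omega>. (c n * f n \<omega>)\<^sup>2)) \<le> R\<^sup>2"
    using assms(5) expectation_abs_mult_f_powr_eq_weight[of _ _ 2] by simp
qed

text \<open>Duality: \<open>g\<close> is tested against \<open>\<Sum> d\<^sub>n f\<^sub>n\<close> with \<open>\<bar>d\<^sub>n\<bar> = \<bar>coefficient g n\<bar>\<^bsup>p-1\<^esup>\<close>. As the span of
  the \<open>f\<^sub>n\<close> satisfies an upper \<open>q\<close>-estimate with constant 1, Young's inequality gives the sharp bound.\<close>

lemma coefficient_powr_sum_le:
  assumes "finite A" "2 \<le> p" and g: "g \<in> borel_measurable M" "integrable M (\<lambda>x. \<bar>g x\<bar> powr p)"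
  shows "(\<Sum>n\<in>A. \<bar>coefficient g n\<bar> powr p * weight n) \<le> expectation (\<lambda>x. \<bar>g x\<bar> powr p)"
proof -
  define q where "q = p / (p - 1)"
  have q: "1 < q" "q \<le> 2" "1 / p + 1 / q = 1" "(p - 1) * q = p"
    using \<open>2 \<le> p\<close> by (auto simp: q_def field_simps)
  define d where "d n = sgn (coefficient g n) * \<bar>coefficient g n\<bar> powr (p - 1)" for n
  let ?E = "\<Sum>n\<in>A. \<bar>coefficient g n\<bar> powr p * weight n"
  have g_L2: "square_integrable M g"
    using \<open>2 \<le> p\<close> g by (rule square_integrable_of_powr)
  have d_powr: "\<bar>d n\<bar> powr q = \<bar>coefficient g n\<bar> powr p" for n
    by (simp add: d_def abs_sgn_mult_abs_powr powr_powr q)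
  have "?E = expectation (\<lambda>x. g x * combination d A x)"
    by (simp add: integral_mult_combination[OF g_L2] d_def sgn_mult_abs_powr_mult)
  also have "\<dots> \<le> expectation (\<lambda>x. \<bar>g x\<bar> powr p / p + \<bar>combination d A x\<bar> powr q / q)"
  proof (rule integral_mono)
    show "g x * combination d A x \<le> \<bar>g x\<bar> powr p / p + \<bar>combination d A x\<bar> powr q / q" for x
      using Youngs_inequality[of p q "\<bar>g x\<bar>" "\<bar>combination d A x\<bar>"] q \<open>2 \<le> p\<close>
        abs_ge_self[of "g x * combination d A x"]
      by (simp add: abs_mult)
    show "integrable M (\<lambda>x. g x * combination d A x)"
      by (intro integrable_mult_square_integrable g_L2 combination_L2)
    show "integrable M (\<lambda>x. \<bar>g x\<bar> powr p / p + \<bar>combination d A x\<bar> powr q / q)"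
      using q g by (simp add: integrable_combination_powr)
  qed
  also have "\<dots> = expectation (\<lambda>x. \<bar>g x\<bar> powr p) / p + expectation (\<lambda>x. \<bar>combination d A x\<bar> powr q) / q"
    using q g by (simp add: integrable_combination_powr)
  also have "\<dots> \<le> expectation (\<lambda>x. \<bar>g x\<bar> powr p) / p + ?E / q"
    using expectation_combination_powr_le[of A q d] q \<open>finite A\<close>
    by (intro add_left_mono divide_right_mono) (auto simp: d_powr)
  finally have "?E * (1 - 1 / q) \<le> expectation (\<lambda>x. \<bar>g x\<bar> powr p) / p"
    by (simp add: algebra_simps)
  also have "1 - 1 / q = 1 / p"
    using q by simp
  finally show ?thesis
    using \<open>2 \<le> p\<close> by (simp add: divide_right_mono field_simps)
qed

lemma L2_sums_powr_le:
  assumes g: "L2_sums c g" and "2 < p" "0 \<le> R"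
    and "\<And>N. (\<Sum>n<N. \<bar>c n\<bar> powr p * weight n) \<le> R powr p"
    and "\<And>N. (\<Sum>n<N. (c n)\<^sup>2 * weight n) \<le> R\<^sup>2"
  shows "integrable M (\<lambda>x. \<bar>g x\<bar> powr p)"
    and "expectation (\<lambda>x. \<bar>g x\<bar> powr p) \<le> (6.8 * (p / ln p) * R) powr p"
proof -
  have [measurable]: "g \<in> borel_measurable M"
    using g by (simp add: L2_sums_def square_integrable_measurable)
  obtain r where "AE x in M. (\<lambda>k. combination c {..<r k} x - g x) \<longlonglongrightarrow> 0"
    using L2_tendsto_0_AE_subseq[of M "\<lambda>N x. combination c {..<N} x - g x"] g
    by (auto simp: L2_sums_def square_integrable_diff combination_L2)
  then have lim: "AE x in M. (\<lambda>k. \<bar>combination c {..<r k} x\<bar> powr p) \<longlonglongrightarrow> \<bar>g x\<bar> powr p"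
  proof eventually_elim
    case (elim x)
    from LIM_zero_cancel[OF this] show ?case
      using \<open>2 < p\<close> by (intro tendsto_powr' tendsto_rabs tendsto_const) auto
  qed
  have int: "integrable M (\<lambda>x. \<bar>combination c {..<r k} x\<bar> powr p)" for k
    using \<open>2 < p\<close> by (intro integrable_combination_powr) auto
  have le: "expectation (\<lambda>x. \<bar>combination c {..<r k} x\<bar> powr p) \<le> (6.8 * (p / ln p) * R) powr p" for k
    by (intro rosenthal_combination assms(2-)) auto
  show "integrable M (\<lambda>x. \<bar>g x\<bar> powr p)" "expectation (\<lambda>x. \<bar>g x\<bar> powr p) \<le> (6.8 * (p / ln p) * R) powr p"
    by (rule integral_le_of_tendsto_AE[OF int powr_ge_zero _ lim le]; measurable)+
qed

end

subsection \<open>Orthogonal projections and \<open>L\<^sub>p\<close> on the unit interval\<close>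

interpretation U: prob_space U
  by (rule prob_spaceI) (simp add: emeasure_restrict_space)

lemma memLq_2_iff: "memLq 2 f \<longleftrightarrow> square_integrable U f"
  by (simp add: memLq_def square_integrable_def power2_eq_abs_powr del: powr_numeral)

lemma normLq_nonneg [simp]: "0 \<le> normLq q f"
  by (simp add: normLq_def)

lemma normLq_powr: "0 < q \<Longrightarrow> normLq q f powr q = (\<integral>t. \<bar>f t\<bar> powr q \<partial>U)"
  by (simp add: normLq_def powr_powr)

lemma normLq_leI:
  assumes "0 < q" "0 \<le> B" "(\<integral>t. \<bar>f t\<bar> powr q \<partial>U) \<le> B powr q"
  shows "normLq q f \<le> B"
  using powr_mono2[OF _ _ assms(3), of "1 / q"] assms(1,2) by (simp add: normLq_def powr_powr)

lemma memLq_imp_square_integrable: "2 \<le> p \<Longrightarrow> memLq p f \<Longrightarrow> square_integrable U f"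
  unfolding memLq_def by (blast intro: U.square_integrable_of_powr)

lemma L2_norm_le_normLq: "2 \<le> p \<Longrightarrow> memLq p f \<Longrightarrow> L2_norm U f \<le> normLq p f"
  unfolding memLq_def normLq_def by (blast intro: U.square_integrable_of_powr)

lemma memLq_diff: "1 \<le> p \<Longrightarrow> memLq p f \<Longrightarrow> memLq p g \<Longrightarrow> memLq p (\<lambda>t. f t - g t)"
  using integrable_abs_powr_add[of p f U "\<lambda>t. - g t"] by (auto simp: memLq_def)

lemma orth_proj_L2_square_integrable:
  "orth_proj_L2 P \<Longrightarrow> square_integrable U f \<Longrightarrow> square_integrable U (P f)"
  by (simp add: orth_proj_L2_def memLq_2_iff)

lemma orth_proj_L2_norm_le:
  assumes P: "orth_proj_L2 P" and f: "square_integrable U f"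
  shows "L2_norm U (P f) \<le> L2_norm U f"
proof -
  note P_L2 = orth_proj_L2_square_integrable[OF P]
  have "(L2_norm U (P f))\<^sup>2 = (\<integral>t. P f t * P f t \<partial>U)"
    by (simp add: integral_mult_self)
  also have "\<dots> = (\<integral>t. f t * P (P f) t \<partial>U)"
    using P f P_L2 by (simp add: orth_proj_L2_def memLq_2_iff)
  also have "\<dots> = (\<integral>t. f t * P f t \<partial>U)"
  proof (rule integral_cong_AE)
    have "AE t in U. P (P f) t = P f t"
      using P f by (simp add: orth_proj_L2_def ae_eq_def memLq_2_iff)
    then show "AE t in U. f t * P (P f) t = f t * P f t"
      by eventually_elim simp
  qed (intro borel_measurable_times square_integrable_measurable f P_L2)+
  also have "\<dots> \<le> L2_norm U f * L2_norm U (P f)"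
    using L2_Cauchy_Schwarz[OF f P_L2[OF f]] by simp
  finally show ?thesis
    using L2_norm_nonneg[of U "P f"]
    by (cases "L2_norm U (P f) = 0") (auto simp: power2_eq_square less_le)
qed

lemma orth_proj_L2_dist_le:
  assumes P: "orth_proj_L2 P" and g: "square_integrable U g" and h: "square_integrable U h"
  shows "L2_norm U (\<lambda>t. P g t - g t) \<le> 2 * L2_norm U (\<lambda>t. g t - P h t)"
proof -
  note P_L2 = orth_proj_L2_square_integrable[OF P]
  have diff_L2: "square_integrable U (\<lambda>t. g t - P h t)"
    by (intro square_integrable_diff g P_L2 h)
  have "AE t in U. P (P h) t = P h t"
    using P h by (simp add: orth_proj_L2_def ae_eq_def memLq_2_iff)
  moreover have "AE t in U. P (\<lambda>t. 1 * g t + (- 1) * P h t) t = 1 * P g t + (- 1) * P (P h) t"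
    using P g P_L2[OF h] unfolding orth_proj_L2_def ae_eq_def memLq_2_iff by blast
  ultimately have "AE t in U. P g t - P h t = P (\<lambda>t. g t - P h t) t"
    by eventually_elim simp
  then have "L2_norm U (\<lambda>t. P g t - P h t) = L2_norm U (P (\<lambda>t. g t - P h t))"
    by (intro L2_norm_cong_AE square_integrable_measurable square_integrable_diff P_L2 g h diff_L2)
  also have "\<dots> \<le> L2_norm U (\<lambda>t. g t - P h t)"
    by (rule orth_proj_L2_norm_le[OF P diff_L2])
  finally show ?thesis
    using L2_norm_diff_triangle[OF P_L2[OF g] P_L2[OF h] g]
    by (simp add: L2_norm_minus_commute[of U "P h" g])
qed

lemma Lp_closure_range_fixed:
  assumes P: "orth_proj_L2 P" and bounded: "p_C_bounded p C P" and "2 \<le> p"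
    and g: "g \<in> Lp_closure_range p P"
  shows "ae_eq (P g) g"
proof -
  have g_Lp: "memLq p g"
    using g by (simp add: Lp_closure_range_def)
  then have g_L2: "square_integrable U g"
    using \<open>2 \<le> p\<close> by (rule memLq_imp_square_integrable[rotated])
  have "L2_norm U (\<lambda>t. P g t - g t) \<le> 0"
  proof (rule field_le_epsilon)
    fix e :: real assume "0 < e"
    then obtain h where h: "memLq 2 h" "memLq p h" and close: "normLq p (\<lambda>t. g t - P h t) < e / 2"
      using g unfolding Lp_closure_range_def by (auto dest!: spec[of _ "e / 2"])
    have "memLq p (\<lambda>t. g t - P h t)"
      using h bounded \<open>2 \<le> p\<close> g_Lp by (intro memLq_diff) (auto simp: p_C_bounded_def)
    then have "L2_norm U (\<lambda>t. g t - P h t) \<le> normLq p (\<lambda>t. g t - P h t)"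
      by (rule L2_norm_le_normLq[OF \<open>2 \<le> p\<close>])
    moreover have "L2_norm U (\<lambda>t. P g t - g t) \<le> 2 * L2_norm U (\<lambda>t. g t - P h t)"
      using P g_L2 h(1) unfolding memLq_2_iff by (rule orth_proj_L2_dist_le)
    ultimately show "L2_norm U (\<lambda>t. P g t - g t) \<le> 0 + e"
      using close by linarith
  qed
  then have "L2_norm U (\<lambda>t. P g t - g t) = 0"
    by (simp add: antisym)
  then show ?thesis
    using L2_norm_eq_0_AE[of U "\<lambda>t. P g t - g t"]
    by (simp add: ae_eq_def square_integrable_diff orth_proj_L2_square_integrable[OF P] g_L2)
qed

lemma p_C_bounded_mono:
  assumes "p_C_bounded p C P" "C \<le> D"
  shows "p_C_bounded p D P"
  using assms mult_right_mono[OF assms(2) normLq_nonneg] unfolding p_C_bounded_def by (meson order_trans)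

subsection \<open>The spaces \<open>X\<^sub>p\<^sub>,\<^sub>w\<close>\<close>

lemma norm_Xpw_nonneg: "0 \<le> norm_Xpw p w x"
  by (simp add: norm_Xpw_def le_max_iff_disj)

lemma sum_powr_le_norm_Xpw:
  assumes "0 < p" and x: "in_Xpw p w x"
  shows "(\<Sum>n<N. \<bar>x n\<bar> powr p) \<le> norm_Xpw p w x powr p"
proof -
  let ?A = "\<Sum>n. \<bar>x n\<bar> powr p"
  have summable: "summable (\<lambda>n. \<bar>x n\<bar> powr p)"
    using x by (simp add: in_Xpw_def)
  have "(\<Sum>n<N. \<bar>x n\<bar> powr p) \<le> ?A"
    using summable by (intro sum_le_suminf) auto
  also have "\<dots> = (?A powr (1 / p)) powr p"
    using summable \<open>0 < p\<close> by (simp add: powr_powr suminf_nonneg)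
  also have "\<dots> \<le> norm_Xpw p w x powr p"
    using \<open>0 < p\<close> by (intro powr_mono2) (auto simp: norm_Xpw_def)
  finally show ?thesis .
qed

lemma sum_square_le_norm_Xpw:
  assumes x: "in_Xpw p w x"
  shows "(\<Sum>n<N. (x n * w n)\<^sup>2) \<le> (norm_Xpw p w x)\<^sup>2"
proof -
  let ?B = "\<Sum>n. (x n * w n)\<^sup>2"
  have summable: "summable (\<lambda>n. (x n * w n)\<^sup>2)"
    using x by (simp add: in_Xpw_def)
  have "(\<Sum>n<N. (x n * w n)\<^sup>2) \<le> ?B"
    using summable by (intro sum_le_suminf) auto
  also have "\<dots> = (sqrt ?B)\<^sup>2"
    using summable by (simp add: suminf_nonneg)
  also have "\<dots> \<le> (norm_Xpw p w x)\<^sup>2"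
    using summable by (intro power_mono) (auto simp: norm_Xpw_def suminf_nonneg)
  finally show ?thesis .
qed

lemma in_Xpw_norm_leI:
  assumes "0 < p" "0 \<le> K"
    and powr_le: "\<And>N. (\<Sum>n<N. \<bar>x n\<bar> powr p) \<le> K powr p"
    and square_le: "\<And>N. (\<Sum>n<N. (x n * w n)\<^sup>2) \<le> K\<^sup>2"
  shows "in_Xpw p w x" and "norm_Xpw p w x \<le> K"
proof -
  have summable_powr: "summable (\<lambda>n. \<bar>x n\<bar> powr p)"
    by (rule summableI_nonneg_bounded[OF _ powr_le]) simp
  have summable_square: "summable (\<lambda>n. (x n * w n)\<^sup>2)"
    by (rule summableI_nonneg_bounded[OF _ square_le]) simp
  show "in_Xpw p w x"
    using summable_powr summable_square by (simp add: in_Xpw_def)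
  have "(\<Sum>n. \<bar>x n\<bar> powr p) powr (1 / p) \<le> (K powr p) powr (1 / p)"
    using \<open>0 < p\<close>
    by (intro powr_mono2 suminf_le_const[OF summable_powr powr_le] suminf_nonneg[OF summable_powr]) auto
  moreover have "sqrt (\<Sum>n. (x n * w n)\<^sup>2) \<le> K"
    using \<open>0 \<le> K\<close> by (intro real_le_lsqrt suminf_le_const[OF summable_square square_le])
  ultimately show "norm_Xpw p w x \<le> K"
    using \<open>0 < p\<close> \<open>0 \<le> K\<close> by (simp add: norm_Xpw_def powr_powr)
qed

lemma in_Xpw_mono:
  assumes "0 < p" "1 \<le> b" and le: "\<And>n. \<bar>v n\<bar> \<le> b * \<bar>w n\<bar>" and x: "in_Xpw p w x"
  shows "in_Xpw p v x" and "norm_Xpw p v x \<le> b * norm_Xpw p w x"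
proof -
  have "0 \<le> b * norm_Xpw p w x"
    using \<open>1 \<le> b\<close> norm_Xpw_nonneg[of p w x] by simp
  moreover have "(\<Sum>n<N. \<bar>x n\<bar> powr p) \<le> (b * norm_Xpw p w x) powr p" for N
  proof -
    have "norm_Xpw p w x powr p \<le> (b * norm_Xpw p w x) powr p"
      using \<open>0 < p\<close> \<open>1 \<le> b\<close> norm_Xpw_nonneg[of p w x]
      by (intro powr_mono2) (auto simp: mult_le_cancel_right1)
    then show ?thesis
      using sum_powr_le_norm_Xpw[OF \<open>0 < p\<close> x, of N] by linarith
  qed
  moreover have "(\<Sum>n<N. (x n * v n)\<^sup>2) \<le> (b * norm_Xpw p w x)\<^sup>2" for N
  proof -
    have "(x n * v n)\<^sup>2 \<le> b\<^sup>2 * (x n * w n)\<^sup>2" for n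
    proof -
      have "(v n)\<^sup>2 \<le> (b * w n)\<^sup>2"
        using le[of n] \<open>1 \<le> b\<close> by (simp add: abs_le_square_iff[symmetric] abs_mult)
      then show ?thesis
        using mult_left_mono[of "(v n)\<^sup>2" "(b * w n)\<^sup>2" "(x n)\<^sup>2"] by (simp add: power_mult_distrib mult_ac)
    qed
    then have "(\<Sum>n<N. (x n * v n)\<^sup>2) \<le> b\<^sup>2 * (\<Sum>n<N. (x n * w n)\<^sup>2)"
      by (simp add: sum_distrib_left sum_mono)
    also have "\<dots> \<le> b\<^sup>2 * (norm_Xpw p w x)\<^sup>2"
      by (intro mult_left_mono sum_square_le_norm_Xpw[OF x]) simp
    finally show ?thesis
      by (simp add: power_mult_distrib)
  qed
  ultimately show "in_Xpw p v x" "norm_Xpw p v x \<le> b * norm_Xpw p w x"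
    using in_Xpw_norm_leI[OF \<open>0 < p\<close>] by blast+
qed

lemma Xpw_isomorphic_to_equivalent_weight:
  assumes "0 < p"
    and v_le: "\<And>n. \<bar>v n\<bar> \<le> a * \<bar>w n\<bar>" and w_le: "\<And>n. \<bar>w n\<bar> \<le> a' * \<bar>v n\<bar>"
    and iso: "Xpw_isomorphic_to p v X"
  shows "Xpw_isomorphic_to p w X"
proof -
  define b where "b = Max {1, a, a'}"
  have "1 \<le> b"
    by (simp add: b_def)
  have comparable: "\<bar>v n\<bar> \<le> b * \<bar>w n\<bar>" "\<bar>w n\<bar> \<le> b * \<bar>v n\<bar>" for n
    by (rule order_trans[OF v_le] order_trans[OF w_le], rule mult_right_mono, simp_all add: b_def)+
  note v_of_w = in_Xpw_mono[OF \<open>0 < p\<close> \<open>1 \<le> b\<close>, of v w, OF comparable(1)]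
    and w_of_v = in_Xpw_mono[OF \<open>0 < p\<close> \<open>1 \<le> b\<close>, of w v, OF comparable(2)]
  have in_iff: "in_Xpw p w x \<longleftrightarrow> in_Xpw p v x" for x
    using v_of_w(1) w_of_v(1) by blast
  obtain T l u where T: "0 < l" "0 < u"
    "\<forall>x. in_Xpw p w x \<longrightarrow> T x \<in> X"
    "\<forall>x y c d. in_Xpw p w x \<longrightarrow> in_Xpw p w y \<longrightarrow>
      ae_eq (T (\<lambda>n. c * x n + d * y n)) (\<lambda>t. c * T x t + d * T y t)"
    "\<forall>g\<in>X. \<exists>x. in_Xpw p w x \<and> ae_eq (T x) g"
    and norm_T: "\<And>x. in_Xpw p w x \<Longrightarrow>
      l * norm_Xpw p v x \<le> normLq p (T x) \<and> normLq p (T x) \<le> u * norm_Xpw p v x"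
    using iso unfolding Xpw_isomorphic_to_def in_iff by auto
  have "l / b * norm_Xpw p w x \<le> normLq p (T x) \<and> normLq p (T x) \<le> u * b * norm_Xpw p w x"
    if x: "in_Xpw p w x" for x
  proof
    have "l / b * norm_Xpw p w x \<le> l * norm_Xpw p v x"
      using w_of_v(2)[of x] x \<open>0 < l\<close> \<open>1 \<le> b\<close> by (simp add: in_iff field_simps)
    then show "l / b * norm_Xpw p w x \<le> normLq p (T x)"
      using norm_T[OF x] by simp
    have "u * norm_Xpw p v x \<le> u * b * norm_Xpw p w x"
      using v_of_w(2)[OF x] \<open>0 < u\<close> by simp
    then show "normLq p (T x) \<le> u * b * norm_Xpw p w x"
      using norm_T[OF x] by simp
  qed
  then show ?thesis
    unfolding Xpw_isomorphic_to_def using T \<open>1 \<le> b\<close>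
    by (intro exI[of _ T] exI[of _ "l / b"] exI[of _ "u * b"]) simp
qed

subsection \<open>The span of a symmetric ternary sequence on the unit interval\<close>

locale unit_interval_ternary_sequence = symmetric_ternary_sequence U f for f
begin

lemma orth_proj_L2_projection: "orth_proj_L2 projection"
  unfolding orth_proj_L2_def memLq_2_iff ae_eq_def
proof (intro conjI allI impI)
  show "square_integrable U (projection g)" if "square_integrable U g" for g
    using L2_sums_projection[OF that] by (rule L2_sums_square_integrable)
  show "AE t in U. projection g t = projection h t"
    if "square_integrable U g" "square_integrable U h" "AE t in U. g t = h t" for g h
    by (simp add: projection_cong_AE[OF that])
qed (simp_all add: projection_linear projection_self_adjoint projection_idem)

lemma coefficient_powr_sum_le_normLq:
  assumes "2 \<le> p" "memLq p g" "finite A"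
  shows "(\<Sum>n\<in>A. \<bar>coefficient g n\<bar> powr p * weight n) \<le> normLq p g powr p"
  using coefficient_powr_sum_le[of A p g] assms by (simp add: memLq_def normLq_powr)

lemma coefficient_square_sum_le_normLq:
  assumes "2 \<le> p" "memLq p g" "finite A"
  shows "(\<Sum>n\<in>A. (coefficient g n)\<^sup>2 * weight n) \<le> (normLq p g)\<^sup>2"
proof -
  have "(L2_norm U g)\<^sup>2 \<le> (normLq p g)\<^sup>2"
    using L2_norm_le_normLq[OF assms(1,2)] by (intro power_mono) auto
  then show ?thesis
    using bessel[OF \<open>finite A\<close> memLq_imp_square_integrable[OF assms(1,2)]] by linarith
qed

lemma memLq_L2_sums:
  assumes "L2_sums c g" "2 < p" "0 \<le> R"
    and "\<And>N. (\<Sum>n<N. \<bar>c n\<bar> powr p * weight n) \<le> R powr p" "\<And>N. (\<Sum>n<N. (c n)\<^sup>2 * weight n) \<le> R\<^sup>2"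
  shows "memLq p g" and "normLq p g \<le> 6.8 * (p / ln p) * R"
proof -
  note bounds = L2_sums_powr_le[OF assms]
  show "memLq p g"
    using bounds(1) assms(1)
    by (simp add: memLq_def L2_sums_square_integrable square_integrable_measurable)
  show "normLq p g \<le> 6.8 * (p / ln p) * R"
    using bounds(2) assms(2,3) by (intro normLq_leI) auto
qed

lemma p_C_bounded_projection:
  assumes "2 < p"
  shows "p_C_bounded p (6.8 * (p / ln p)) projection"
  unfolding p_C_bounded_def memLq_2_iff
proof (intro allI impI)
  fix g assume g: "square_integrable U g \<and> memLq p g"
  with assms have "L2_sums (coefficient g) (projection g)"
    and "(\<Sum>n<N. \<bar>coefficient g n\<bar> powr p * weight n) \<le> normLq p g powr p"
    and "(\<Sum>n<N. (coefficient g n)\<^sup>2 * weight n) \<le> (normLq p g)\<^sup>2" for N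
    by (auto intro: L2_sums_projection coefficient_powr_sum_le_normLq coefficient_square_sum_le_normLq)
  then show "memLq p (projection g) \<and> normLq p (projection g) \<le> 6.8 * (p / ln p) * normLq p g"
    using memLq_L2_sums[OF _ assms normLq_nonneg] by blast
qed

lemma C_orth_complemented_closure_range:
  assumes "2 < p"
  shows "C_orth_complemented p (7.35 * (p / ln p)) (Lp_closure_range p projection)"
proof -
  have "p_C_bounded p (7.35 * (p / ln p)) projection"
    by (rule p_C_bounded_mono[OF p_C_bounded_projection[OF assms]])
      (use assms in \<open>simp add: field_simps\<close>)
  then show ?thesis
    unfolding C_orth_complemented_def using orth_proj_L2_projection by blast
qed

text \<open>As \<open>\<integral> \<bar>f\<^sub>n\<bar>\<^sup>p = weight n\<close>, the unit vectors of \<open>L\<^sub>p\<close> in the directions \<open>f\<^sub>n\<close> are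
  \<open>f\<^sub>n / weight n\<^bsup>1/p\<^esup>\<close>, and their \<open>L\<^sub>2\<close> norms are \<open>weight n\<^bsup>1/2 - 1/p\<^esup>\<close>.\<close>

definition normalize_coefficients :: "real \<Rightarrow> (nat \<Rightarrow> real) \<Rightarrow> nat \<Rightarrow> real" where
  "normalize_coefficients p x n = x n * weight n powr (- 1 / p)"

definition rosenthal_weight :: "real \<Rightarrow> nat \<Rightarrow> real" where
  "rosenthal_weight p n = weight n powr (1 / 2 - 1 / p)"

definition embedding :: "real \<Rightarrow> (nat \<Rightarrow> real) \<Rightarrow> real \<Rightarrow> real" where
  "embedding p x = series (normalize_coefficients p x)"

lemma rosenthal_weight_pos: "0 < rosenthal_weight p n"
  using weight_pos[of n] by (simp add: rosenthal_weight_def)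

lemma normalize_coefficients_linear:
  "normalize_coefficients p (\<lambda>n. c * x n + d * y n)
    = (\<lambda>n. c * normalize_coefficients p x n + d * normalize_coefficients p y n)"
  by (simp add: normalize_coefficients_def algebra_simps fun_eq_iff)

lemma normalize_coefficients_powr:
  assumes "0 < p"
  shows "\<bar>normalize_coefficients p x n\<bar> powr p * weight n = \<bar>x n\<bar> powr p"
proof -
  have "(weight n powr (- 1 / p)) powr p = weight n powr (- 1)"
    using assms by (simp add: powr_powr)
  also have "\<dots> = inverse (weight n)"
    using weight_pos[of n] by (simp add: powr_minus)
  finally show ?thesis
    using weight_pos[of n] by (simp add: normalize_coefficients_def abs_mult powr_mult)
qed

lemma normalize_coefficients_square:
  "(normalize_coefficients p x n)\<^sup>2 * weight n = (x n * rosenthal_weight p n)\<^sup>2"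
proof -
  have "(weight n powr (- 1 / p))\<^sup>2 * weight n
      = weight n powr (- 1 / p) * weight n powr (- 1 / p) * weight n powr 1"
    using weight_pos[of n] by (simp add: power2_eq_square)
  also have "\<dots> = weight n powr (1 / 2 - 1 / p) * weight n powr (1 / 2 - 1 / p)"
    by (simp only: powr_add[symmetric]) simp
  finally show ?thesis
    by (simp add: normalize_coefficients_def rosenthal_weight_def power_mult_distrib power2_eq_square)
qed

lemma L2_sums_embedding:
  "in_Xpw p (rosenthal_weight p) x \<Longrightarrow> L2_sums (normalize_coefficients p x) (embedding p x)"
  unfolding embedding_def by (intro L2_sums_series) (simp add: normalize_coefficients_square in_Xpw_def)

lemma
  assumes "2 < p" and x: "in_Xpw p (rosenthal_weight p) x"
  shows memLq_embedding: "memLq p (embedding p x)"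
    and normLq_embedding_le: "normLq p (embedding p x)
      \<le> 6.8 * (p / ln p) * norm_Xpw p (rosenthal_weight p) x"
proof -
  have "(\<Sum>n<N. \<bar>normalize_coefficients p x n\<bar> powr p * weight n)
      \<le> norm_Xpw p (rosenthal_weight p) x powr p"
    "(\<Sum>n<N. (normalize_coefficients p x n)\<^sup>2 * weight n) \<le> (norm_Xpw p (rosenthal_weight p) x)\<^sup>2" for N
    using assms by (simp_all add: normalize_coefficients_powr normalize_coefficients_square
        sum_powr_le_norm_Xpw sum_square_le_norm_Xpw)
  from memLq_L2_sums[OF L2_sums_embedding[OF x] \<open>2 < p\<close> norm_Xpw_nonneg this]
  show "memLq p (embedding p x)"
    "normLq p (embedding p x) \<le> 6.8 * (p / ln p) * norm_Xpw p (rosenthal_weight p) x" .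
qed

lemma
  assumes "2 \<le> p" and g: "memLq p g" and coeff: "coefficient g = normalize_coefficients p x"
  shows in_Xpw_of_coefficient: "in_Xpw p (rosenthal_weight p) x"
    and norm_Xpw_le_of_coefficient: "norm_Xpw p (rosenthal_weight p) x \<le> normLq p g"
proof -
  have "(\<Sum>n<N. \<bar>x n\<bar> powr p) \<le> normLq p g powr p" "(\<Sum>n<N. (x n * rosenthal_weight p n)\<^sup>2) \<le> (normLq p g)\<^sup>2"
    for N
    using coefficient_powr_sum_le_normLq[OF \<open>2 \<le> p\<close> g, of "{..<N}"]
      coefficient_square_sum_le_normLq[OF \<open>2 \<le> p\<close> g, of "{..<N}"] \<open>2 \<le> p\<close>
    by (simp_all add: coeff normalize_coefficients_powr normalize_coefficients_square)
  with \<open>2 \<le> p\<close> show "in_Xpw p (rosenthal_weight p) x" "norm_Xpw p (rosenthal_weight p) x \<le> normLq p g"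
    using in_Xpw_norm_leI[of p "normLq p g" x "rosenthal_weight p"] by auto
qed

lemma embedding_in_closure_range:
  assumes "2 < p" and x: "in_Xpw p (rosenthal_weight p) x"
  shows "embedding p x \<in> Lp_closure_range p projection"
proof -
  have L2: "memLq 2 (embedding p x)"
    using L2_sums_embedding[OF x] by (simp add: memLq_2_iff L2_sums_square_integrable)
  have "projection (embedding p x) = embedding p x"
    unfolding embedding_def using x
    by (intro projection_series) (simp add: normalize_coefficients_square in_Xpw_def)
  then have "normLq p (\<lambda>t. embedding p x t - projection (embedding p x) t) = 0"
    using \<open>2 < p\<close> by (simp add: normLq_def)
  then show ?thesis
    using memLq_embedding[OF assms] L2 unfolding Lp_closure_range_def
    by (auto intro!: exI[of _ "embedding p x"])
qed

lemma embedding_linear: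
  assumes x: "in_Xpw p (rosenthal_weight p) x" and y: "in_Xpw p (rosenthal_weight p) y"
  shows "ae_eq (embedding p (\<lambda>n. c * x n + d * y n)) (\<lambda>t. c * embedding p x t + d * embedding p y t)"
proof -
  let ?c = "normalize_coefficients p (\<lambda>n. c * x n + d * y n)"
  have sum: "L2_sums ?c (\<lambda>t. c * embedding p x t + d * embedding p y t)"
    unfolding normalize_coefficients_linear by (intro L2_sums_linear L2_sums_embedding x y)
  from summable_coefficient[OF L2_sums_square_integrable[OF this]]
  have "summable (\<lambda>n. (?c n)\<^sup>2 * weight n)"
    by (simp only: coefficient_L2_sums[OF sum])
  then show ?thesis
    unfolding ae_eq_def embedding_def[of p "\<lambda>n. c * x n + d * y n"]
    by (intro L2_sums_unique[OF L2_sums_series sum])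
qed

lemma embedding_surj:
  assumes "2 < p" and g: "g \<in> Lp_closure_range p projection"
  shows "\<exists>x. in_Xpw p (rosenthal_weight p) x \<and> ae_eq (embedding p x) g"
proof -
  define x where "x n = coefficient g n * weight n powr (1 / p)" for n
  have coeff: "coefficient g = normalize_coefficients p x"
    using weight_pos
    by (simp add: normalize_coefficients_def x_def powr_minus less_imp_neq[symmetric] fun_eq_iff)
  have "in_Xpw p (rosenthal_weight p) x"
    using \<open>2 < p\<close> g by (intro in_Xpw_of_coefficient[OF _ _ coeff]) (auto simp: Lp_closure_range_def)
  moreover have "ae_eq (projection g) g"
    using Lp_closure_range_fixed[OF orth_proj_L2_projection p_C_bounded_projection _ g] \<open>2 < p\<close> by simp
  ultimately show ?thesis
    by (auto simp: embedding_def projection_def coeff)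
qed

theorem Xpw_isomorphic_to_closure_range:
  assumes "2 < p"
  shows "Xpw_isomorphic_to p (rosenthal_weight p) (Lp_closure_range p projection)"
  unfolding Xpw_isomorphic_to_def
proof (rule exI[of _ "embedding p"], rule exI[of _ 1], rule exI[of _ "6.8 * (p / ln p)"],
    intro conjI allI ballI impI)
  show "1 * norm_Xpw p (rosenthal_weight p) x \<le> normLq p (embedding p x)"
    if "in_Xpw p (rosenthal_weight p) x" for x
    using norm_Xpw_le_of_coefficient[OF _ memLq_embedding[OF assms that]
      coefficient_L2_sums[OF L2_sums_embedding[OF that]]]
      assms by simp
  show "normLq p (embedding p x) \<le> 6.8 * (p / ln p) * norm_Xpw p (rosenthal_weight p) x"
    if "in_Xpw p (rosenthal_weight p) x" for x
    by (rule normLq_embedding_le[OF assms that])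
qed (use assms in \<open>auto intro: embedding_in_closure_range embedding_linear embedding_surj\<close>)

end

subsection \<open>Independent digits\<close>

lemma (in prob_space) indep_vars_natI:
  assumes rv: "\<And>n. random_variable (S n) (X n)"
    and prod: "\<And>A N. (\<And>n. A n \<in> sets (S n)) \<Longrightarrow>
      \<P>(\<omega> in M. \<forall>n<N. X n \<omega> \<in> A n) = (\<Prod>n<N. \<P>(\<omega> in M. X n \<omega> \<in> A n))"
  shows "indep_vars S X (UNIV :: nat set)"
  unfolding indep_vars_def2 indep_sets_def
proof (intro conjI ballI allI impI)
  show "{X n -` A \<inter> space M |A. A \<in> sets (S n)} \<subseteq> events" for n
    using measurable_sets[OF rv] by blast
  fix J and E :: "nat \<Rightarrow> 'a set"
  assume J: "J \<noteq> {}" "finite J" and "E \<in> (\<Pi> n\<in>J. {X n -` A \<inter> space M |A. A \<in> sets (S n)})"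
  then have "\<forall>n\<in>J. \<exists>A. A \<in> sets (S n) \<and> E n = X n -` A \<inter> space M"
    by blast
  then obtain A where A: "\<And>n. n \<in> J \<Longrightarrow> A n \<in> sets (S n)" "\<And>n. n \<in> J \<Longrightarrow> E n = X n -` A n \<inter> space M"
    by metis
  define B where "B n = (if n \<in> J then A n else space (S n))" for n
  have B: "B n \<in> sets (S n)" for n
    using A by (simp add: B_def)
  obtain N where N: "J \<subseteq> {..<N}"
    using \<open>finite J\<close> finite_nat_bounded by blast
  have X_space: "X n \<omega> \<in> space (S n)" if "\<omega> \<in> space M" for n \<omega>
    using measurable_space[OF rv that] .
  have "(\<Inter>n\<in>J. E n) = (\<Inter>n\<in>J. X n -` A n \<inter> space M)"
    using A(2) by simp
  also have "\<dots> = {\<omega> \<in> space M. \<forall>n\<in>J. X n \<omega> \<in> A n}"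
    using J(1) by auto
  also have "\<dots> = {\<omega> \<in> space M. \<forall>n<N. X n \<omega> \<in> B n}"
    using N X_space by (auto simp: B_def)
  finally have "prob (\<Inter>n\<in>J. E n) = (\<Prod>n<N. \<P>(\<omega> in M. X n \<omega> \<in> B n))"
    using prod[OF B] by simp
  also have "\<dots> = (\<Prod>n\<in>J. prob (E n))"
  proof (rule prod.mono_neutral_cong_right)
    show "\<forall>n\<in>{..<N} - J. \<P>(\<omega> in M. X n \<omega> \<in> B n) = 1"
      using X_space prob_space by (simp add: B_def cong: conj_cong)
    show "\<P>(\<omega> in M. X n \<omega> \<in> B n) = prob (E n)" if "n \<in> J" for n
      unfolding A(2)[OF that] using that by (intro arg_cong[where f = prob]) (auto simp: B_def)
  qed (use N in auto)
  finally show "prob (\<Inter>n\<in>J. E n) = (\<Prod>n\<in>J. prob (E n))" .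
qed (use rv in auto)

text \<open>\<open>digit M n t\<close> is the \<open>n\<close>-th digit of \<open>t\<close> in the mixed radix \<open>M 0, M 1, \<dots>\<close>; at the endpoint
  \<open>t = 1\<close> all digits are \<open>0\<close>.\<close>

definition digit :: "(nat \<Rightarrow> nat) \<Rightarrow> nat \<Rightarrow> real \<Rightarrow> nat" where
  "digit M n t = nat \<lfloor>real (\<Prod>i\<le>n. M i) * t\<rfloor> mod M n"

lemma measurable_borel_imp_U: "h \<in> measurable borel N \<Longrightarrow> h \<in> measurable U N"
  by (auto intro!: measurable_restrict_space1 measurable_completion)

lemma digit_measurable [measurable]: "digit M n \<in> measurable U (count_space UNIV)"
  unfolding digit_def by (rule measurable_borel_imp_U) measurable

lemma nat_floor_div:
  assumes "0 \<le> x"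
  shows "nat \<lfloor>x / real k\<rfloor> = nat \<lfloor>x\<rfloor> div k"
  using floor_divide_real_eq_div[of "int k" x] assms by (simp add: nat_div_distrib)

lemma nat_div_mod_eq_iff:
  fixes a j k m :: nat
  assumes "a < m"
  shows "k div m = j \<and> k mod m = a \<longleftrightarrow> k = j * m + a"
  using assms div_mult_mod_eq[of k m] by auto

lemma digits_eq_iff_floor_eq:
  assumes "\<And>n. n < N \<Longrightarrow> a n < M n"
  obtains j where "j < (\<Prod>i<N. M i)"
    "\<And>t. 0 \<le> t \<Longrightarrow> t < 1 \<Longrightarrow> (\<forall>n<N. digit M n t = a n) \<longleftrightarrow> nat \<lfloor>real (\<Prod>i<N. M i) * t\<rfloor> = j"
  using assms
proof (induction N arbitrary: thesis)
  case 0
  then show ?case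
    by (auto simp: floor_eq_iff)
next
  case (Suc N)
  obtain j where j: "j < (\<Prod>i<N. M i)"
    and digits: "\<And>t. 0 \<le> t \<Longrightarrow> t < 1 \<Longrightarrow>
      (\<forall>n<N. digit M n t = a n) \<longleftrightarrow> nat \<lfloor>real (\<Prod>i<N. M i) * t\<rfloor> = j"
    using Suc.IH Suc.prems(2) by (metis less_Suc_eq)
  have a: "a N < M N"
    using Suc.prems(2) by simp
  show ?case
  proof (rule Suc.prems(1))
    have "j * M N + a N < (j + 1) * M N"
      using a by simp
    also have "\<dots> \<le> (\<Prod>i<N. M i) * M N"
      using j by (intro mult_right_mono) auto
    finally show "j * M N + a N < (\<Prod>i<Suc N. M i)"
      by simp
  next
    fix t :: real assume t: "0 \<le> t" "t < 1"
    let ?k = "nat \<lfloor>real (\<Prod>i<Suc N. M i) * t\<rfloor>"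
    have "nat \<lfloor>real (\<Prod>i<N. M i) * t\<rfloor> = ?k div M N"
      using nat_floor_div[of "real (\<Prod>i<Suc N. M i) * t" "M N"] t a by (simp add: prod_nonneg)
    moreover have "digit M N t = ?k mod M N"
      by (simp add: digit_def flip: lessThan_Suc_atMost)
    ultimately have "(\<forall>n<Suc N. digit M n t = a n) \<longleftrightarrow> ?k div M N = j \<and> ?k mod M N = a N"
      using digits[OF t] by (auto simp: less_Suc_eq)
    also have "\<dots> \<longleftrightarrow> ?k = j * M N + a N"
      by (rule nat_div_mod_eq_iff[OF a])
    finally show "(\<forall>n<Suc N. digit M n t = a n) \<longleftrightarrow> ?k = j * M N + a N" .
  qed
qed

lemma prob_nat_floor_eq:
  assumes "j < L"
  shows "\<P>(t in U. t < 1 \<and> nat \<lfloor>real L * t\<rfloor> = j) = 1 / real L"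
proof -
  let ?I = "{real j / real L..<real (Suc j) / real L}"
  have "0 \<le> real j / real L" "real (Suc j) / real L \<le> 1"
    using assms by simp_all
  then have sub: "?I \<subseteq> {0..<1}"
    by (meson atLeastLessThan_iff order.strict_trans2 order_trans subsetI)
  have "nat \<lfloor>real L * t\<rfloor> = j \<longleftrightarrow> t \<in> ?I" if "0 \<le> t" for t
    using assms that by (auto simp: nat_eq_iff floor_eq_iff field_simps)
  with sub have "{t \<in> space U. t < 1 \<and> nat \<lfloor>real L * t\<rfloor> = j} = ?I"
    by (fastforce simp: space_restrict_space)
  moreover have "measure U ?I = measure lebesgue ?I"
    by (rule measure_restrict_space[OF _ order_trans[OF sub]]) auto
  ultimately show ?thesis
    using assms by (simp add: diff_divide_distrib[symmetric] divide_right_mono)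
qed

lemma AE_less_1: "AE t in U. t < 1"
proof (rule AE_I')
  show "{1} \<in> null_sets U"
    by (auto simp: null_sets_restrict_space)
qed (auto simp: space_restrict_space)

lemma prob_digits_eq:
  assumes "\<And>n. n < N \<Longrightarrow> a n < M n"
  shows "\<P>(t in U. \<forall>n<N. digit M n t = a n) = 1 / real (\<Prod>n<N. M n)"
proof -
  obtain j where "j < (\<Prod>i<N. M i)"
    and digits: "\<And>t. 0 \<le> t \<Longrightarrow> t < 1 \<Longrightarrow>
      (\<forall>n<N. digit M n t = a n) \<longleftrightarrow> nat \<lfloor>real (\<Prod>i<N. M i) * t\<rfloor> = j"
    using digits_eq_iff_floor_eq[of N a M] assms by blast
  have "\<P>(t in U. \<forall>n<N. digit M n t = a n) = \<P>(t in U. t < 1 \<and> nat \<lfloor>real (\<Prod>i<N. M i) * t\<rfloor> = j)"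
  proof (rule U.prob_eq_AE)
    show "AE t in U. (\<forall>n<N. digit M n t = a n) \<longleftrightarrow> t < 1 \<and> nat \<lfloor>real (\<Prod>i<N. M i) * t\<rfloor> = j"
      using AE_less_1 AE_space by eventually_elim (simp add: digits space_restrict_space)
    show "{t \<in> space U. \<forall>n<N. digit M n t = a n} \<in> sets U"
      by measurable
    show "{t \<in> space U. t < 1 \<and> nat \<lfloor>real (\<Prod>i<N. M i) * t\<rfloor> = j} \<in> sets U"
      by (rule predE, rule measurable_borel_imp_U) measurable
  qed
  then show ?thesis
    using prob_nat_floor_eq[OF \<open>j < (\<Prod>i<N. M i)\<close>] by simp
qed

lemma prob_digits_in:
  assumes M: "\<And>n. 0 < M n"
  shows "\<P>(t in U. \<forall>n<N. digit M n t \<in> A n) = (\<Prod>n<N. card (A n \<inter> {..<M n}) / M n)"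
proof -
  let ?words = "\<Pi>\<^sub>E n\<in>{..<N}. A n \<inter> {..<M n}"
  let ?cylinder = "\<lambda>a. {t \<in> space U. \<forall>n<N. digit M n t = a n}"
  have union: "{t \<in> space U. \<forall>n<N. digit M n t \<in> A n} = (\<Union>a\<in>?words. ?cylinder a)"
  proof (intro equalityI subsetI)
    fix t assume "t \<in> {t \<in> space U. \<forall>n<N. digit M n t \<in> A n}"
    then show "t \<in> (\<Union>a\<in>?words. ?cylinder a)"
      using M by (intro UN_I[of "\<lambda>n\<in>{..<N}. digit M n t"]) (auto simp: digit_def)
  qed (auto simp: PiE_iff)
  have "U.prob (\<Union>a\<in>?words. ?cylinder a) = (\<Sum>a\<in>?words. \<P>(t in U. \<forall>n<N. digit M n t = a n))"
  proof (rule U.finite_measure_finite_Union)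
    show "finite ?words"
      by (intro finite_PiE) auto
    show "?cylinder ` ?words \<subseteq> sets U"
      by (intro image_subsetI) measurable
    show "disjoint_family_on ?cylinder ?words"
      unfolding disjoint_family_on_def
    proof (intro ballI impI)
      fix a b assume "a \<in> ?words" "b \<in> ?words" "a \<noteq> b"
      then obtain n where "n < N" "a n \<noteq> b n"
        using PiE_ext[of a "{..<N}" _ b] by blast
      then show "?cylinder a \<inter> ?cylinder b = {}"
        by auto
    qed
  qed
  also have "\<dots> = (\<Sum>a\<in>?words. 1 / real (\<Prod>n<N. M n))"
    by (intro sum.cong refl prob_digits_eq) (auto simp: PiE_iff)
  also have "\<dots> = (\<Prod>n<N. card (A n \<inter> {..<M n}) / M n)"
    by (simp add: card_PiE prod_dividef)
  finally show ?thesis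
    unfolding union .
qed

lemma prob_digit_in:
  assumes M: "\<And>n. 0 < M n"
  shows "\<P>(t in U. digit M n t \<in> A) = card (A \<inter> {..<M n}) / M n"
proof -
  have "\<P>(t in U. digit M n t \<in> A) = \<P>(t in U. \<forall>k<Suc n. digit M k t \<in> (if k = n then A else UNIV))"
    by (intro arg_cong[where f = U.prob]) auto
  also have "\<dots> = card (A \<inter> {..<M n}) / M n"
    unfolding prob_digits_in[OF M] using M by (simp add: less_imp_neq[symmetric])
  finally show ?thesis .
qed

lemma indep_vars_digit:
  assumes M: "\<And>n. 0 < M n"
  shows "U.indep_vars (\<lambda>_. count_space UNIV) (digit M) UNIV"
  by (rule U.indep_vars_natI) (simp_all only: digit_measurable prob_digits_in[OF M] prob_digit_in[OF M])

definition sign_of_digit :: "nat \<Rightarrow> real" where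
  "sign_of_digit k = (if k = 0 then 1 else if k = 1 then - 1 else 0)"

lemma sign_of_digit_transpose: "sign_of_digit (Transposition.transpose 0 1 k) = - sign_of_digit k"
  by (simp add: sign_of_digit_def Transposition.transpose_def)

lemma symmetric_var_sign_of_digit:
  assumes M: "\<And>n. 2 \<le> M n"
  shows "U.symmetric_var (\<lambda>t. sign_of_digit (digit M n t))"
proof -
  have M_pos: "0 < M n" for n
    using M[of n] by simp
  have "distr U borel (\<lambda>t. - sign_of_digit (digit M n t))
      = distr U borel (\<lambda>t. sign_of_digit (digit M n t))"
  proof (rule measure_eqI)
    fix B :: "real set" assume "B \<in> sets (distr U borel (\<lambda>t. - sign_of_digit (digit M n t)))"
    then have [measurable]: "B \<in> sets borel"
      by simp
    let ?swap = "Transposition.transpose 0 (1::nat)"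
    have law: "emeasure (distr U borel (\<lambda>t. s (digit M n t))) B
        = ennreal (card (s -` B \<inter> {..<M n}) / M n)"
      for s :: "nat \<Rightarrow> real"
      unfolding prob_digit_in[of M n "s -` B", OF M_pos, symmetric]
      by (subst emeasure_distr) (auto simp: U.emeasure_eq_measure intro!: arg_cong[where f = U.prob])
    have "?swap k < M n \<longleftrightarrow> k < M n" for k
      using M[of n] by (auto simp: Transposition.transpose_def)
    then have "bij_betw ?swap ((\<lambda>k. - sign_of_digit k) -` B \<inter> {..<M n}) (sign_of_digit -` B \<inter> {..<M n})"
      by (intro bij_betwI[where g = ?swap]) (auto simp: sign_of_digit_transpose[unfolded One_nat_def])
    then show "emeasure (distr U borel (\<lambda>t. - sign_of_digit (digit M n t))) B
        = emeasure (distr U borel (\<lambda>t. sign_of_digit (digit M n t))) B"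
      using law[of sign_of_digit] law[of "\<lambda>k. - sign_of_digit k"] by (simp add: bij_betw_same_card)
  qed simp
  then show ?thesis
    by (simp add: U.symmetric_var_def)
qed

lemma prob_sign_of_digit:
  assumes M: "\<And>n. 2 \<le> M n"
  shows "\<P>(t in U. sign_of_digit (digit M n t) \<noteq> 0) = 2 / M n"
proof -
  have M_pos: "0 < M n" for n
    using M[of n] by simp
  have "sign_of_digit k \<noteq> 0 \<longleftrightarrow> k \<in> {0, 1}" for k
    by (simp add: sign_of_digit_def)
  then have "\<P>(t in U. sign_of_digit (digit M n t) \<noteq> 0) = card ({0, 1} \<inter> {..<M n}) / M n"
    by (simp only: prob_digit_in[of M, OF M_pos])
  also have "{0, 1} \<inter> {..<M n} = {0, 1}"
    using M[of n] by auto
  finally show ?thesis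
    by simp
qed

lemma unit_interval_ternary_sequence_sign_of_digit:
  assumes M: "\<And>n. 2 \<le> M n"
  shows "unit_interval_ternary_sequence (\<lambda>n t. sign_of_digit (digit M n t))"
proof
  have M_pos: "0 < M n" for n
    using M[of n] by simp
  show "U.indep_vars (\<lambda>_. borel) (\<lambda>n t. sign_of_digit (digit M n t)) UNIV"
    by (rule U.indep_vars_compose2[OF indep_vars_digit[OF M_pos]]) simp
  fix n
  show "U.symmetric_var (\<lambda>t. sign_of_digit (digit M n t))"
    by (rule symmetric_var_sign_of_digit[OF M])
  show "sign_of_digit (digit M n t) \<in> {- 1, 0, 1}" for t
    by (simp add: sign_of_digit_def)
  show "0 < \<P>(t in U. sign_of_digit (digit M n t) \<noteq> 0)"
    unfolding prob_sign_of_digit[OF M] using M_pos[of n] by simp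
qed

lemma ex_nat_two_divide_approx:
  fixes y :: real
  assumes "0 < y" "y \<le> 1"
  shows "\<exists>m::nat\<ge>2. 2 / real m \<le> y \<and> y \<le> 2 * (2 / real m)"
proof -
  define m where "m = nat \<lceil>2 / y\<rceil>"
  have "2 \<le> 2 / y"
    using assms by (simp add: field_simps)
  moreover have "2 / y \<le> real m" "real m \<le> 2 / y + 1"
    using assms by (auto simp: m_def of_nat_ceiling)
  ultimately have "2 \<le> m" "2 / y \<le> real m" "real m \<le> 4 / y"
    by (simp_all add: field_simps)
  then show ?thesis
    using assms by (intro exI[of _ m]) (auto simp: field_simps)
qed

lemma ex_nat_powr_approx:
  fixes u :: real
  assumes "0 < e" "e \<le> 1" "0 < u" "u \<le> 1"
  shows "\<exists>m::nat\<ge>2. (2 / m) powr e \<le> u \<and> u \<le> 2 * (2 / m) powr e"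
proof -
  have "0 < u powr (1 / e)" "u powr (1 / e) \<le> 1"
    using assms by (auto intro: powr_le1)
  then obtain m :: nat where "2 \<le> m" and m: "2 / m \<le> u powr (1 / e)" "u powr (1 / e) \<le> 2 * (2 / m)"
    using ex_nat_two_divide_approx by blast
  have "(2 / m) powr e \<le> (u powr (1 / e)) powr e"
    using m(1) \<open>0 < e\<close> by (intro powr_mono2) auto
  moreover have "(u powr (1 / e)) powr e \<le> (2 * (2 / m)) powr e"
    using m(2) \<open>0 < e\<close> by (intro powr_mono2) auto
  moreover have "(2 * (2 / m)) powr e \<le> 2 * (2 / m) powr e"
    using powr_mono[of e 1 2] \<open>e \<le> 1\<close> by (simp add: powr_mult mult_right_mono del: times_divide_eq_right)
  moreover have "(u powr (1 / e)) powr e = u"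
    using assms by (simp add: powr_powr)
  ultimately show ?thesis
    using \<open>2 \<le> m\<close> by (intro exI[of _ m]) auto
qed

lemma ex_unit_interval_ternary_sequence:
  fixes u :: "nat \<Rightarrow> real"
  assumes "2 < p" and u: "\<And>n. 0 < u n" "\<And>n. u n \<le> 1"
  obtains f where "unit_interval_ternary_sequence f"
    "\<And>n. unit_interval_ternary_sequence.rosenthal_weight f p n \<le> u n"
    "\<And>n. u n \<le> 2 * unit_interval_ternary_sequence.rosenthal_weight f p n"
proof -
  define e where "e = 1 / 2 - 1 / p"
  have "0 < e" "e \<le> 1"
    using \<open>2 < p\<close> by (auto simp: e_def field_simps)
  then obtain M :: "nat \<Rightarrow> nat" where M: "\<And>n. 2 \<le> M n"
    and approx: "\<And>n. (2 / M n) powr e \<le> u n" "\<And>n. u n \<le> 2 * (2 / M n) powr e"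
    using ex_nat_powr_approx[OF _ _ u] by metis
  define f where "f n t = sign_of_digit (digit M n t)" for n t
  have f: "unit_interval_ternary_sequence f"
    unfolding f_def by (rule unit_interval_ternary_sequence_sign_of_digit[OF M])
  then interpret unit_interval_ternary_sequence f .
  have "rosenthal_weight p n = (2 / M n) powr e" for n
    unfolding rosenthal_weight_def weight_eq_prob e_def f_def by (simp only: prob_sign_of_digit[OF M])
  with approx show ?thesis
    by (intro that[OF f]) simp_all
qed

theorem mainTheorem2:
  fixes p :: real and w :: "nat \<Rightarrow> real"
  assumes "2 < p"
    and "\<And>n. 0 < w n"
    and "w \<longlonglongrightarrow> 0"
    and "\<not> summable (\<lambda>n. w n powr (2 * p / (p - 2)))"
  shows "\<exists>X. C_orth_complemented p (7.35 * (p / ln p)) X \<and> Xpw_isomorphic_to p w X"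
proof -
  obtain W where W: "0 < W" "\<And>n. w n \<le> W"
    using convergent_imp_Bseq[OF convergentI[OF assms(3)]] by (auto simp: Bseq_def abs_le_iff)
  obtain f where "unit_interval_ternary_sequence f"
    and approx: "\<And>n. unit_interval_ternary_sequence.rosenthal_weight f p n \<le> w n / W"
      "\<And>n. w n / W \<le> 2 * unit_interval_ternary_sequence.rosenthal_weight f p n"
    using ex_unit_interval_ternary_sequence[OF assms(1), of "\<lambda>n. w n / W"] W assms(2) by auto
  then interpret unit_interval_ternary_sequence f
    by simp
  have "rosenthal_weight p n \<le> 1 / W * w n" "w n \<le> 2 * W * rosenthal_weight p n" for n
    using approx[of n] W(1) by (simp_all add: field_simps)
  then have "Xpw_isomorphic_to p w (Lp_closure_range p projection)"
    using Xpw_isomorphic_to_closure_range[OF assms(1)] assms(1,2) rosenthal_weight_pos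
    by (intro Xpw_isomorphic_to_equivalent_weight[of p "rosenthal_weight p" "1 / W" w "2 * W"])
      (auto simp: abs_of_pos)
  then show ?thesis
    using C_orth_complemented_closure_range[OF assms(1)] by blast
qed

end
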